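(* Let $(M,g,J,\Psi)$ be an almost Calabi-Yau with torsion (ACYT) 6-manifold with torsion connection $\nabla$ and torsion 3-form $T$. Then the $SU(3)$-Hull connection $\nabla^h$ is an $SU(3)$-instanton if and only if the torsion is closed, $dT=0$.
   Context: Setting. $M$ is a smooth 6-manifold, $g$ a Riemannian metric, $J$ an almost complex structure with $g(JX,JY)=g(X,Y)$. The Kähler form is $F(X,Y)=g(X,JY)$. $SU(3)$-structure. $\Psi=\Psi^++\sqrt{-1}\,\Psi^-$ is a complex 3-form of type $(3,0)$ with respect to $J$ such that near each point there is a local orthonormal coframe $e_1,\dots,e_6$ with $F=-e_{12}-e_{34}-e_{56}$ and $\Psi=-(e_1+\sqrt{-1}e_2)\wedge(e_3+\sqrt{-1}e_4)\wedge(e_5+\sqrt{-1}e_6)$ (here $e_{ij}=e_i\wedge e_j$). ACYT. $(M,g,J,\Psi)$ is ACYT if there is a linear connection $\nabla$ with $\nabla g=\nabla J=\nabla\Psi^+=\nabla\Psi^-=0$ whose torsion $T(X,Y)=\nabla_XY-\nabla_YX-[X,Y]$ is totally skew-symmetric, i.e. $T(X,Y,Z)=g(T(X,Y),Z)$ is a 3-form. Such a $\nabla$ is unique and is called the torsion connection; $T$ is called the torsion. Hull connection. The $SU(3)$-Hull connection $\nabla^h$ is the metric connection with torsion $-T$, i.e. $\nabla^h=\nabla^g-\frac12T=\nabla-T$, where $\nabla^g$ is the Levi-Civita connection; explicitly $g(\nabla^h_XY,Z)=g(\nabla^g_XY,Z)-\frac12T(X,Y,Z)$. Instanton. Let $R^h(X,Y)Z=[\nabla^h_X,\nabla^h_Y]Z-\nabla^h_{[X,Y]}Z$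 and $R^h(X,Y,Z,V)=g(R^h(X,Y)Z,V)$. The connection $\nabla^h$ is an $SU(3)$-instanton if its curvature 2-form lies in $\mathfrak{su}(3)$ in its first two arguments: $R^h(JX,JY,Z,V)=R^h(X,Y,Z,V)$ and $\sum_{i=1}^6R^h(e_i,Je_i,Z,V)=0$ for all $X,Y,Z,V$ and any orthonormal basis $\{e_i\}$. *)

theory Defs
  imports "HOL-Analysis.Analysis" "HOL-Library.Function_Algebras"
begin

text \<open>Pointwise real vector space structure on functions; the additive part is
  in Function_Algebras. It is used for tangent vectors (operators on functions) and for
  vector fields.\<close>

instantiation "fun" :: (type, real_vector) real_vector
begin

definition scaleR_fun :: "real \<Rightarrow> ('a \<Rightarrow> 'b) \<Rightarrow> 'a \<Rightarrow> 'b"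
  where "scaleR_fun c f = (\<lambda>x. c *\<^sub>R f x)"

instance
  by standard (auto simp: scaleR_fun_def fun_eq_iff scaleR_add_left scaleR_add_right)

end


section \<open>Smooth manifolds\<close>

primrec Ck_on :: "nat \<Rightarrow> ('a::real_normed_vector \<Rightarrow> 'b::real_normed_vector) \<Rightarrow> 'a set \<Rightarrow> bool"
  where
    "Ck_on 0 f S \<longleftrightarrow> continuous_on S f"
  | "Ck_on (Suc k) f S \<longleftrightarrow> (\<forall>x\<in>S. f differentiable (at x)) \<and>
       (\<forall>v. Ck_on k (\<lambda>x. frechet_derivative f (at x) v) S)"

text \<open>Only used for open \<open>S\<close>.\<close>

definition smooth_on :: "('a::real_normed_vector \<Rightarrow> 'b::real_normed_vector) \<Rightarrow> 'a set \<Rightarrow> bool"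
  where "smooth_on f S \<longleftrightarrow> (\<forall>k. Ck_on k f S)"

text \<open>The manifold is the whole type \<open>'m\<close>. A chart is a pair of an open domain and a coordinate
  map, whose values outside the domain are irrelevant. In \<open>smooth_manifold\<close> the Hausdorff and
  second countability requirements are the type class constraints on \<open>'m\<close>.\<close>

type_synonym ('m, 'n) chart = "'m set \<times> ('m \<Rightarrow> real ^ 'n)"

definition is_chart :: "('m::topological_space, 'n::finite) chart \<Rightarrow> bool"
  where "is_chart c \<longleftrightarrow> (case c of (U, \<phi>) \<Rightarrow>
    open U \<and> open (\<phi> ` U) \<and> homeomorphism U (\<phi> ` U) \<phi> (inv_into U \<phi>))"

definition smooth_manifold ::
  "('m::{t2_space,second_countable_topology}, 'n::finite) chart set \<Rightarrow> bool"
  where "smooth_manifold A \<longleftrightarrow>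
    (\<forall>c\<in>A. is_chart c) \<and>
    (\<Union>(U, \<phi>)\<in>A. U) = UNIV \<and>
    (\<forall>(U, \<phi>)\<in>A. \<forall>(V, \<psi>)\<in>A. smooth_on (\<psi> \<circ> inv_into U \<phi>) (\<phi> ` (U \<inter> V)))"

definition smooth_fun_on ::
  "('m::topological_space, 'n::finite) chart set \<Rightarrow> 'm set \<Rightarrow> ('m \<Rightarrow> real) \<Rightarrow> bool"
  where "smooth_fun_on A W f \<longleftrightarrow>
    (\<forall>(U, \<phi>)\<in>A. smooth_on (f \<circ> inv_into U \<phi>) (\<phi> ` (U \<inter> W)))"

abbreviation smooth_fun ::
  "('m::topological_space, 'n::finite) chart set \<Rightarrow> ('m \<Rightarrow> real) \<Rightarrow> bool"
  where "smooth_fun A \<equiv> smooth_fun_on A UNIV"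

text \<open>A tangent vector at \<open>p\<close> is the operator on smooth functions given by the directional
  derivative along some \<open>w\<close> in some chart around \<open>p\<close>. It is set to 0 on
  functions that are not smooth, so that tangent vectors agreeing on smooth functions are equal.\<close>

type_synonym 'm tvec = "('m \<Rightarrow> real) \<Rightarrow> real"

definition tangent_space ::
  "('m::topological_space, 'n::finite) chart set \<Rightarrow> 'm \<Rightarrow> 'm tvec set"
  where "tangent_space A p =
    {v. \<exists>U \<phi> w. (U, \<phi>) \<in> A \<and> p \<in> U \<and>
      v = (\<lambda>f. if smooth_fun A f
               then frechet_derivative (f \<circ> inv_into U \<phi>) (at (\<phi> p)) w else 0)}"


section \<open>Vector fields and connections\<close>

type_synonym 'm vfield = "'m \<Rightarrow> 'm tvec"

definition vfields :: "('m::topological_space, 'n::finite) chart set \<Rightarrow> 'm vfield set"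
  where "vfields A = {X. (\<forall>p. X p \<in> tangent_space A p) \<and>
    (\<forall>f. smooth_fun A f \<longrightarrow> smooth_fun A (\<lambda>p. X p f))}"

definition vderiv :: "'m vfield \<Rightarrow> ('m \<Rightarrow> real) \<Rightarrow> 'm \<Rightarrow> real"
  where "vderiv X f = (\<lambda>p. X p f)"

definition fmul :: "('m \<Rightarrow> real) \<Rightarrow> 'm vfield \<Rightarrow> 'm vfield"
  where "fmul f X = (\<lambda>p. f p *\<^sub>R X p)"

definition lie_bracket :: "'m vfield \<Rightarrow> 'm vfield \<Rightarrow> 'm vfield"
  where "lie_bracket X Y = (\<lambda>p f. vderiv X (vderiv Y f) p - vderiv Y (vderiv X f) p)"

type_synonym 'm connection = "'m vfield \<Rightarrow> 'm vfield \<Rightarrow> 'm vfield"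

definition linear_connection ::
  "('m::topological_space, 'n::finite) chart set \<Rightarrow> 'm connection \<Rightarrow> bool"
  where "linear_connection A D \<longleftrightarrow>
    (\<forall>X\<in>vfields A. \<forall>Y\<in>vfields A. D X Y \<in> vfields A) \<and>
    (\<forall>X\<in>vfields A. \<forall>X'\<in>vfields A. \<forall>Y\<in>vfields A. D (X + X') Y = D X Y + D X' Y) \<and>
    (\<forall>X\<in>vfields A. \<forall>Y\<in>vfields A. \<forall>Y'\<in>vfields A. D X (Y + Y') = D X Y + D X Y') \<and>
    (\<forall>f. \<forall>X\<in>vfields A. \<forall>Y\<in>vfields A. smooth_fun A f \<longrightarrow>
       D (fmul f X) Y = fmul f (D X Y) \<and>
       D X (fmul f Y) = fmul (vderiv X f) Y + fmul f (D X Y))"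

definition torsion :: "'m connection \<Rightarrow> 'm vfield \<Rightarrow> 'm vfield \<Rightarrow> 'm vfield"
  where "torsion D X Y = D X Y - D Y X - lie_bracket X Y"

definition curvature :: "'m connection \<Rightarrow> 'm vfield \<Rightarrow> 'm vfield \<Rightarrow> 'm vfield \<Rightarrow> 'm vfield"
  where "curvature D X Y Z = D X (D Y Z) - D Y (D X Z) - D (lie_bracket X Y) Z"


section \<open>Almost Hermitian and SU(3)-structures\<close>

text \<open>Tensors are given pointwise; their values on arguments that are not tangent vectors at the
  given point are irrelevant.\<close>

type_synonym 'm bilin = "'m \<Rightarrow> 'm tvec \<Rightarrow> 'm tvec \<Rightarrow> real"
type_synonym 'm endo = "'m \<Rightarrow> 'm tvec \<Rightarrow> 'm tvec"
type_synonym 'm cform3 = "'m \<Rightarrow> 'm tvec \<Rightarrow> 'm tvec \<Rightarrow> 'm tvec \<Rightarrow> complex"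

definition gval :: "'m bilin \<Rightarrow> 'm vfield \<Rightarrow> 'm vfield \<Rightarrow> 'm \<Rightarrow> real"
  where "gval g X Y = (\<lambda>p. g p (X p) (Y p))"

definition Jval :: "'m endo \<Rightarrow> 'm vfield \<Rightarrow> 'm vfield"
  where "Jval J X = (\<lambda>p. J p (X p))"

definition riemannian_metric ::
  "('m::topological_space, 'n::finite) chart set \<Rightarrow> 'm bilin \<Rightarrow> bool"
  where "riemannian_metric A g \<longleftrightarrow>
    (\<forall>p. \<forall>u\<in>tangent_space A p. \<forall>v\<in>tangent_space A p. \<forall>w\<in>tangent_space A p. \<forall>c.
       g p (u + v) w = g p u w + g p v w \<and>
       g p (c *\<^sub>R u) w = c * g p u w \<and>
       g p u v = g p v u \<and>
       (u \<noteq> 0 \<longrightarrow> g p u u > 0)) \<and>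
    (\<forall>X\<in>vfields A. \<forall>Y\<in>vfields A. smooth_fun A (gval g X Y))"

definition almost_complex ::
  "('m::topological_space, 'n::finite) chart set \<Rightarrow> 'm endo \<Rightarrow> bool"
  where "almost_complex A J \<longleftrightarrow>
    (\<forall>p. \<forall>u\<in>tangent_space A p. \<forall>v\<in>tangent_space A p. \<forall>c.
       J p u \<in> tangent_space A p \<and>
       J p (u + v) = J p u + J p v \<and>
       J p (c *\<^sub>R u) = c *\<^sub>R J p u \<and>
       J p (J p u) = - u) \<and>
    (\<forall>X\<in>vfields A. Jval J X \<in> vfields A)"

definition almost_hermitian ::
  "('m::topological_space, 'n::finite) chart set \<Rightarrow> 'm bilin \<Rightarrow> 'm endo \<Rightarrow> bool"
  where "almost_hermitian A g J \<longleftrightarrow> riemannian_metric A g \<and> almost_complex A J \<and>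
    (\<forall>p. \<forall>u\<in>tangent_space A p. \<forall>v\<in>tangent_space A p. g p (J p u) (J p v) = g p u v)"

definition kahler_form :: "'m bilin \<Rightarrow> 'm endo \<Rightarrow> 'm bilin"
  where "kahler_form g J p u v = g p u (J p v)"

definition complex_3form ::
  "('m::topological_space, 'n::finite) chart set \<Rightarrow> 'm cform3 \<Rightarrow> bool"
  where "complex_3form A \<Psi> \<longleftrightarrow>
    (\<forall>p. \<forall>u\<in>tangent_space A p. \<forall>u'\<in>tangent_space A p.
         \<forall>v\<in>tangent_space A p. \<forall>w\<in>tangent_space A p. \<forall>c.
       \<Psi> p (u + u') v w = \<Psi> p u v w + \<Psi> p u' v w \<and>
       \<Psi> p (c *\<^sub>R u) v w = c *\<^sub>R \<Psi> p u v w \<and>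
       \<Psi> p u v w = - \<Psi> p v u w \<and>
       \<Psi> p u v w = - \<Psi> p u w v) \<and>
    (\<forall>X\<in>vfields A. \<forall>Y\<in>vfields A. \<forall>Z\<in>vfields A.
       smooth_fun A (\<lambda>p. Re (\<Psi> p (X p) (Y p) (Z p))) \<and>
       smooth_fun A (\<lambda>p. Im (\<Psi> p (X p) (Y p) (Z p))))"

text \<open>A complex 3-form has type (3,0) iff it is complex linear with respect to \<open>J\<close>; by
  antisymmetry the first argument suffices. The (1,0)-forms \<open>\<alpha>\<close> are those with
  \<open>\<alpha> (J v) = \<i> \<alpha> v\<close>.\<close>

definition type_3_0 ::
  "('m::topological_space, 'n::finite) chart set \<Rightarrow> 'm endo \<Rightarrow> 'm cform3 \<Rightarrow> bool"
  where "type_3_0 A J \<Psi> \<longleftrightarrow>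
    (\<forall>p. \<forall>u\<in>tangent_space A p. \<forall>v\<in>tangent_space A p. \<forall>w\<in>tangent_space A p.
       \<Psi> p (J p u) v w = \<i> * \<Psi> p u v w)"

definition wedge2 :: "('v \<Rightarrow> real) \<Rightarrow> ('v \<Rightarrow> real) \<Rightarrow> 'v \<Rightarrow> 'v \<Rightarrow> real"
  where "wedge2 \<alpha> \<beta> u v = \<alpha> u * \<beta> v - \<alpha> v * \<beta> u"

definition wedge3 ::
  "('v \<Rightarrow> complex) \<Rightarrow> ('v \<Rightarrow> complex) \<Rightarrow> ('v \<Rightarrow> complex) \<Rightarrow> 'v \<Rightarrow> 'v \<Rightarrow> 'v \<Rightarrow> complex"
  where "wedge3 \<alpha> \<beta> \<gamma> u v w =
      \<alpha> u * \<beta> v * \<gamma> w + \<alpha> v * \<beta> w * \<gamma> u + \<alpha> w * \<beta> u * \<gamma> v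
    - \<alpha> u * \<beta> w * \<gamma> v - \<alpha> v * \<beta> u * \<gamma> w - \<alpha> w * \<beta> v * \<gamma> u"

text \<open>Bases and coframes on a 6-manifold are indexed by \<open>{1..6}\<close>.\<close>

definition orthonormal_basis ::
  "('m::topological_space, 6) chart set \<Rightarrow> 'm bilin \<Rightarrow> 'm \<Rightarrow> (nat \<Rightarrow> 'm tvec) \<Rightarrow> bool"
  where "orthonormal_basis A g p E \<longleftrightarrow>
    (\<forall>i\<in>{1..6}. E i \<in> tangent_space A p) \<and>
    span (E ` {1..6}) = tangent_space A p \<and>
    (\<forall>i\<in>{1..6}. \<forall>j\<in>{1..6}. g p (E i) (E j) = (if i = j then 1 else 0))"

text \<open>A smooth coframe \<open>e 1, \<dots>, e 6\<close> on the open set \<open>W\<close> that is at each point of \<open>W\<close> the dual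
  basis of an orthonormal basis. Testing smoothness on \<open>W\<close> against global vector fields suffices,
  as every vector field on \<open>W\<close> agrees near each point with a global one.\<close>

definition orthonormal_coframe_on ::
  "('m::topological_space, 6) chart set \<Rightarrow> 'm bilin \<Rightarrow> 'm set \<Rightarrow>
    (nat \<Rightarrow> 'm \<Rightarrow> 'm tvec \<Rightarrow> real) \<Rightarrow> bool"
  where "orthonormal_coframe_on A g W e \<longleftrightarrow>
    (\<forall>i\<in>{1..6}. \<forall>q\<in>W. \<forall>u\<in>tangent_space A q. \<forall>v\<in>tangent_space A q. \<forall>c.
       e i q (u + v) = e i q u + e i q v \<and> e i q (c *\<^sub>R u) = c * e i q u) \<and>
    (\<forall>i\<in>{1..6}. \<forall>X\<in>vfields A. smooth_fun_on A W (\<lambda>q. e i q (X q))) \<and>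
    (\<forall>q\<in>W. \<exists>E. orthonormal_basis A g q E \<and>
       (\<forall>i\<in>{1..6}. \<forall>j\<in>{1..6}. e i q (E j) = (if i = j then 1 else 0)))"

definition su3_structure ::
  "('m::topological_space, 6) chart set \<Rightarrow> 'm bilin \<Rightarrow> 'm endo \<Rightarrow> 'm cform3 \<Rightarrow> bool"
  where "su3_structure A g J \<Psi> \<longleftrightarrow>
    almost_hermitian A g J \<and> complex_3form A \<Psi> \<and> type_3_0 A J \<Psi> \<and>
    (\<forall>p. \<exists>W e. open W \<and> p \<in> W \<and> orthonormal_coframe_on A g W e \<and>
      (\<forall>q\<in>W. \<forall>u\<in>tangent_space A q. \<forall>v\<in>tangent_space A q. \<forall>w\<in>tangent_space A q.
         kahler_form g J q u v =
           - wedge2 (e 1 q) (e 2 q) u v - wedge2 (e 3 q) (e 4 q) u v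
           - wedge2 (e 5 q) (e 6 q) u v \<and>
         \<Psi> q u v w =
           - wedge3 (\<lambda>z. of_real (e 1 q z) + \<i> * of_real (e 2 q z))
                    (\<lambda>z. of_real (e 3 q z) + \<i> * of_real (e 4 q z))
                    (\<lambda>z. of_real (e 5 q z) + \<i> * of_real (e 6 q z)) u v w))"


section \<open>Torsion connection, Hull connection and instantons\<close>

definition parallel_metric ::
  "('m::topological_space, 'n::finite) chart set \<Rightarrow> 'm connection \<Rightarrow> 'm bilin \<Rightarrow> bool"
  where "parallel_metric A D g \<longleftrightarrow> (\<forall>X\<in>vfields A. \<forall>Y\<in>vfields A. \<forall>Z\<in>vfields A.
    vderiv X (gval g Y Z) - gval g (D X Y) Z - gval g Y (D X Z) = 0)"

definition parallel_endo ::
  "('m::topological_space, 'n::finite) chart set \<Rightarrow> 'm connection \<Rightarrow> 'm endo \<Rightarrow> bool"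
  where "parallel_endo A D J \<longleftrightarrow> (\<forall>X\<in>vfields A. \<forall>Y\<in>vfields A.
    D X (Jval J Y) - Jval J (D X Y) = 0)"

type_synonym 'm fform3 = "'m vfield \<Rightarrow> 'm vfield \<Rightarrow> 'm vfield \<Rightarrow> 'm \<Rightarrow> real"

definition parallel_3form ::
  "('m::topological_space, 'n::finite) chart set \<Rightarrow> 'm connection \<Rightarrow> 'm fform3 \<Rightarrow> bool"
  where "parallel_3form A D \<omega> \<longleftrightarrow>
    (\<forall>X\<in>vfields A. \<forall>Y\<in>vfields A. \<forall>Z\<in>vfields A. \<forall>V\<in>vfields A.
      vderiv X (\<omega> Y Z V) - \<omega> (D X Y) Z V - \<omega> Y (D X Z) V - \<omega> Y Z (D X V) = 0)"

definition Re_form :: "'m cform3 \<Rightarrow> 'm fform3"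
  where "Re_form \<Psi> X Y Z = (\<lambda>p. Re (\<Psi> p (X p) (Y p) (Z p)))"

definition Im_form :: "'m cform3 \<Rightarrow> 'm fform3"
  where "Im_form \<Psi> X Y Z = (\<lambda>p. Im (\<Psi> p (X p) (Y p) (Z p)))"

definition torsion_form :: "'m bilin \<Rightarrow> 'm connection \<Rightarrow> 'm fform3"
  where "torsion_form g D X Y Z = gval g (torsion D X Y) Z"

definition totally_skew ::
  "('m::topological_space, 'n::finite) chart set \<Rightarrow> 'm fform3 \<Rightarrow> bool"
  where "totally_skew A \<omega> \<longleftrightarrow> (\<forall>X\<in>vfields A. \<forall>Y\<in>vfields A. \<forall>Z\<in>vfields A.
    \<omega> X Y Z = - \<omega> Y X Z \<and> \<omega> X Y Z = - \<omega> X Z Y)"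

definition torsion_connection ::
  "('m::topological_space, 'n::finite) chart set \<Rightarrow> 'm bilin \<Rightarrow> 'm endo \<Rightarrow> 'm cform3 \<Rightarrow>
    'm connection \<Rightarrow> bool"
  where "torsion_connection A g J \<Psi> D \<longleftrightarrow>
    linear_connection A D \<and>
    parallel_metric A D g \<and> parallel_endo A D J \<and>
    parallel_3form A D (Re_form \<Psi>) \<and> parallel_3form A D (Im_form \<Psi>) \<and>
    totally_skew A (torsion_form g D)"

definition acyt ::
  "('m::topological_space, 6) chart set \<Rightarrow> 'm bilin \<Rightarrow> 'm endo \<Rightarrow> 'm cform3 \<Rightarrow> bool"
  where "acyt A g J \<Psi> \<longleftrightarrow> su3_structure A g J \<Psi> \<and> (\<exists>D. torsion_connection A g J \<Psi> D)"

text \<open>The metric connection whose torsion is the negative of the torsion of \<open>D\<close>; it is unique on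
  vector fields, namely \<open>D X Y - torsion D X Y\<close>.\<close>

definition hull_connection ::
  "('m::topological_space, 'n::finite) chart set \<Rightarrow> 'm bilin \<Rightarrow> 'm connection \<Rightarrow>
    'm connection \<Rightarrow> bool"
  where "hull_connection A g D Dh \<longleftrightarrow>
    linear_connection A Dh \<and> parallel_metric A Dh g \<and>
    (\<forall>X\<in>vfields A. \<forall>Y\<in>vfields A. torsion Dh X Y = - torsion D X Y)"

definition curvature4 ::
  "'m bilin \<Rightarrow> 'm connection \<Rightarrow> 'm vfield \<Rightarrow> 'm vfield \<Rightarrow> 'm vfield \<Rightarrow> 'm vfield \<Rightarrow> 'm \<Rightarrow> real"
  where "curvature4 g D X Y Z V = gval g (curvature D X Y Z) V"

text \<open>The curvature is tensorial, so its values on tangent vectors at \<open>p\<close> are taken through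
  vector fields \<open>E i\<close> which form an orthonormal basis at \<open>p\<close>, but not necessarily elsewhere.\<close>

definition su3_instanton ::
  "('m::topological_space, 6) chart set \<Rightarrow> 'm bilin \<Rightarrow> 'm endo \<Rightarrow> 'm connection \<Rightarrow> bool"
  where "su3_instanton A g J D \<longleftrightarrow>
    (\<forall>X\<in>vfields A. \<forall>Y\<in>vfields A. \<forall>Z\<in>vfields A. \<forall>V\<in>vfields A.
       curvature4 g D (Jval J X) (Jval J Y) Z V = curvature4 g D X Y Z V) \<and>
    (\<forall>Z\<in>vfields A. \<forall>V\<in>vfields A. \<forall>p. \<forall>E.
       (\<forall>i\<in>{1..6}. E i \<in> vfields A) \<and> orthonormal_basis A g p (\<lambda>i. E i p) \<longrightarrow>
       (\<Sum>i=1..6. curvature4 g D (E i) (Jval J (E i)) Z V p) = 0)"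

definition ext_deriv3 ::
  "'m fform3 \<Rightarrow> 'm vfield \<Rightarrow> 'm vfield \<Rightarrow> 'm vfield \<Rightarrow> 'm vfield \<Rightarrow> 'm \<Rightarrow> real"
  where "ext_deriv3 \<omega> X Y Z V =
      vderiv X (\<omega> Y Z V) - vderiv Y (\<omega> X Z V) + vderiv Z (\<omega> X Y V) - vderiv V (\<omega> X Y Z)
    - \<omega> (lie_bracket X Y) Z V + \<omega> (lie_bracket X Z) Y V - \<omega> (lie_bracket X V) Y Z
    - \<omega> (lie_bracket Y Z) X V + \<omega> (lie_bracket Y V) X Z - \<omega> (lie_bracket Z V) X Y"

definition closed_3form ::
  "('m::topological_space, 'n::finite) chart set \<Rightarrow> 'm fform3 \<Rightarrow> bool"
  where "closed_3form A \<omega> \<longleftrightarrow>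
    (\<forall>X\<in>vfields A. \<forall>Y\<in>vfields A. \<forall>Z\<in>vfields A. \<forall>V\<in>vfields A. ext_deriv3 \<omega> X Y Z V = 0)"

end

theory Submission
  imports Defs
begin

text \<open>
  Write \<open>R\<close> and \<open>Rh\<close> for the curvatures of the torsion connection \<open>D\<close> and of the Hull connection
  \<open>Dh = D - T\<close>. The two are linked by the pair exchange formula (\<open>pair_exchange\<close>)

  \<open>dT(X, Y, Z, V) = 2 (R(X, Y, Z, V) - Rh(Z, V, X, Y))\<close>,

  which follows from the first Bianchi identity of \<open>D\<close> (\<open>first_bianchi\<close>), the expression of \<open>Rh\<close> by
  \<open>R\<close>, \<open>D T\<close> and quadratic terms in \<open>T\<close> (\<open>hull_curvature\<close>) and the analogous expression of \<open>dT\<close>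
  (\<open>ext_deriv_torsion\<close>). As \<open>D\<close> preserves the SU(3)-structure, \<open>R(X, Y, Z, V)\<close> is in \<open>su(3)\<close> in \<open>Z, V\<close>:
  it is \<open>J\<close>-invariant because \<open>J\<close> is parallel, and its trace with \<open>J\<close> vanishes because \<open>\<Psi>\<close> is
  parallel (\<open>curvature_trace_zero\<close>).

  If \<open>dT = 0\<close>, the formula says that \<open>Rh(X, Y, Z, V) = R(Z, V, X, Y)\<close>, so \<open>Dh\<close> is an instanton.
  Conversely, if \<open>Dh\<close> is an instanton, \<open>dT\<close> is \<open>J\<close>-invariant and has zero trace with \<open>J\<close> in its last
  two arguments. A 4-form in dimension 6 with zero contraction with the fundamental 2-form
  vanishes (\<open>primitive_4form_zero\<close>): contraction is adjoint to wedging with that form, which maps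
  2-forms isomorphically to 4-forms.

  The objects are given on global vector fields, so two points need care in the second direction.
  Tangent vectors have to be extended to vector fields, which is done with a bump function
  (\<open>vfield_extension\<close>). And \<open>dT(X, Y, Z, V)\<close> at \<open>p\<close> has to be shown to depend on the values at \<open>p\<close> only.
  Here this comes from the instanton condition itself (\<open>dT_local\<close>): the trace condition may be
  tested on any fields that are orthonormal at \<open>p\<close>, so it is stable under adding to them
  fields that vanish at \<open>p\<close>.
\<close>

section \<open>Calculus of smooth maps between normed spaces\<close>

lemma Ck_on_cong:
  assumes "open S" "\<And>x. x \<in> S \<Longrightarrow> f x = g x"
  shows "Ck_on k f S \<longleftrightarrow> Ck_on k g S"
proof -
  have imp: "Ck_on k f S \<Longrightarrow> Ck_on k g S" if "\<And>x. x \<in> S \<Longrightarrow> f x = g x" for f g :: "'a \<Rightarrow> 'b"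
    using that
  proof (induction k arbitrary: f g)
    case 0
    then show ?case by (simp cong: continuous_on_cong)
  next
    case (Suc k)
    have der: "(g has_derivative frechet_derivative f (at x)) (at x)" if "x \<in> S" for x
    proof -
      have "(f has_derivative frechet_derivative f (at x)) (at x)"
        using Suc.prems(1) that by (simp add: frechet_derivative_works[symmetric])
      then show ?thesis
        using Suc.prems(2) has_derivative_transform_within_open \<open>open S\<close> that by blast
    qed
    then have eq: "frechet_derivative g (at x) = frechet_derivative f (at x)" if "x \<in> S" for x
      using that frechet_derivative_at by metis
    have "Ck_on k (\<lambda>x. frechet_derivative g (at x) v) S" for v
      by (rule Suc.IH[of "\<lambda>x. frechet_derivative f (at x) v"]) (use Suc.prems(1) eq in auto)
    moreover have "\<forall>x\<in>S. g differentiable (at x)"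
      using der differentiableI by blast
    ultimately show ?case by simp
  qed
  show ?thesis
    using imp[of f g] imp[of g f] assms(2) by metis
qed

lemma Ck_on_SucI:
  assumes "open S" and der: "\<And>x. x \<in> S \<Longrightarrow> (f has_derivative f' x) (at x)"
    and "\<And>v. Ck_on k (\<lambda>x. f' x v) S"
  shows "Ck_on (Suc k) f S"
proof -
  have "frechet_derivative f (at x) = f' x" if "x \<in> S" for x
    using frechet_derivative_at[OF der[OF that]] by simp
  then have "Ck_on k (\<lambda>x. frechet_derivative f (at x) v) S" for v
    using assms(3)[of v] Ck_on_cong[OF \<open>open S\<close>, of "\<lambda>x. frechet_derivative f (at x) v" "\<lambda>x. f' x v"]
    by simp
  then show ?thesis
    using der by (auto simp: differentiable_def)
qed

lemma Ck_on_Suc_has_derivative: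
  assumes "Ck_on (Suc k) f S" "x \<in> S"
  shows "(f has_derivative frechet_derivative f (at x)) (at x)"
  using assms by (simp add: frechet_derivative_works[symmetric])

lemma Ck_on_subset:
  assumes "Ck_on k f S" "T \<subseteq> S"
  shows "Ck_on k f T"
  using assms by (induction k arbitrary: f) (auto intro: continuous_on_subset)

lemma Ck_on_SucD: "Ck_on (Suc k) f S \<Longrightarrow> Ck_on k f S"
proof (induction k arbitrary: f)
  case 0
  then show ?case
    by (auto intro!: continuous_at_imp_continuous_on differentiable_imp_continuous_within)
next
  case (Suc k)
  have "Ck_on k (\<lambda>x. frechet_derivative f (at x) v) S" for v
    using Suc.prems by (intro Suc.IH) simp
  then show ?case using Suc.prems by simp
qed

lemma Ck_on_const: "open S \<Longrightarrow> Ck_on k (\<lambda>x. c) S"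
proof (induction k arbitrary: c)
  case (Suc k)
  show ?case
    by (rule Ck_on_SucI[where f' = "\<lambda>x v. 0"]) (use Suc in auto)
qed simp

lemma Ck_on_ident: "open S \<Longrightarrow> Ck_on k (\<lambda>x. x) S"
proof (cases k)
  case (Suc k')
  assume "open S"
  then show ?thesis
    unfolding Suc by (intro Ck_on_SucI[where f' = "\<lambda>x v. v"]) (auto intro: Ck_on_const)
qed simp

lemma Ck_on_add:
  assumes "open S" "Ck_on k f S" "Ck_on k g S"
  shows "Ck_on k (\<lambda>x. f x + g x) S"
  using assms(2,3)
proof (induction k arbitrary: f g)
  case 0
  then show ?case by (simp add: continuous_on_add)
next
  case (Suc k)
  show ?case
  proof (rule Ck_on_SucI[OF \<open>open S\<close>])
    show "((\<lambda>x. f x + g x) has_derivative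
        (\<lambda>v. frechet_derivative f (at x) v + frechet_derivative g (at x) v)) (at x)" if "x \<in> S" for x
      using Suc.prems that by (intro has_derivative_add Ck_on_Suc_has_derivative)
    show "Ck_on k (\<lambda>x. frechet_derivative f (at x) v + frechet_derivative g (at x) v) S" for v
      using Suc.prems by (intro Suc.IH) auto
  qed
qed

lemma Ck_on_sum:
  assumes "open S" "\<And>i. i \<in> I \<Longrightarrow> Ck_on k (f i) S"
  shows "Ck_on k (\<lambda>x. \<Sum>i\<in>I. f i x) S"
proof (cases "finite I")
  case True
  from this assms(2) show ?thesis
    by (induction I) (auto intro: Ck_on_const Ck_on_add assms(1))
qed (simp add: Ck_on_const assms(1))

lemma (in bounded_linear) Ck_on_comp:
  assumes "open S" "Ck_on k g S"
  shows "Ck_on k (\<lambda>x. f (g x)) S"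
  using assms(2)
proof (induction k arbitrary: g)
  case 0
  then show ?case by (simp add: continuous_on)
next
  case (Suc k)
  show ?case
  proof (rule Ck_on_SucI[OF \<open>open S\<close>])
    show "((\<lambda>x. f (g x)) has_derivative (\<lambda>v. f (frechet_derivative g (at x) v))) (at x)"
      if "x \<in> S" for x
      using Ck_on_Suc_has_derivative[OF Suc.prems that] by (rule has_derivative)
    show "Ck_on k (\<lambda>x. f (frechet_derivative g (at x) v)) S" for v
      using Suc.prems by (intro Suc.IH) auto
  qed
qed

lemma (in bounded_bilinear) Ck_on_prod:
  assumes "open S" "Ck_on k f S" "Ck_on k g S"
  shows "Ck_on k (\<lambda>x. prod (f x) (g x)) S"
  using assms(2,3)
proof (induction k arbitrary: f g)
  case 0
  then show ?case by (simp add: continuous_on)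
next
  case (Suc k)
  show ?case
  proof (rule Ck_on_SucI[OF \<open>open S\<close>])
    show "((\<lambda>x. prod (f x) (g x)) has_derivative
        (\<lambda>v. prod (f x) (frechet_derivative g (at x) v) + prod (frechet_derivative f (at x) v) (g x)))
        (at x)" if "x \<in> S" for x
      using Suc.prems that by (intro FDERIV Ck_on_Suc_has_derivative)
    show "Ck_on k (\<lambda>x. prod (f x) (frechet_derivative g (at x) v) +
        prod (frechet_derivative f (at x) v) (g x)) S" for v
      using Suc.prems Ck_on_SucD[OF Suc.prems(1)] Ck_on_SucD[OF Suc.prems(2)]
      by (intro Ck_on_add[OF \<open>open S\<close>] Suc.IH) auto
  qed
qed

lemmas Ck_on_scaleR = bounded_bilinear.Ck_on_prod[OF bounded_bilinear_scaleR]
  and Ck_on_inner = bounded_bilinear.Ck_on_prod[OF bounded_bilinear_inner]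
  and Ck_on_minus = bounded_linear.Ck_on_comp[OF bounded_linear_minus[OF bounded_linear_ident]]

text \<open>In the chain rule \<open>D (f \<circ> g) x v\<close> is expanded over a basis of the middle space, because
  the recursion only speaks about derivatives in constant directions.\<close>

lemma Ck_on_compose:
  fixes g :: "'a::real_normed_vector \<Rightarrow> 'b::euclidean_space"
    and f :: "'b \<Rightarrow> 'c::real_normed_vector"
  assumes "open S" "open T" "g ` S \<subseteq> T" "Ck_on k f T" "Ck_on k g S"
  shows "Ck_on k (\<lambda>x. f (g x)) S"
  using assms(4,5)
proof (induction k arbitrary: f)
  case 0
  then show ?case using assms(3) by (auto intro: continuous_on_compose2)
next
  case (Suc k)
  show ?case
  proof (rule Ck_on_SucI[OF \<open>open S\<close>])
    fix x assume x: "x \<in> S"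
    let ?f' = "frechet_derivative f (at (g x))" and ?g' = "frechet_derivative g (at x)"
    have f': "(f has_derivative ?f') (at (g x))"
      using Ck_on_Suc_has_derivative[OF Suc.prems(1)] x assms(3) by blast
    have "((\<lambda>x. f (g x)) has_derivative (\<lambda>v. ?f' (?g' v))) (at x)"
      using has_derivative_compose[OF Ck_on_Suc_has_derivative[OF Suc.prems(2) x] f'] .
    moreover have "?f' (?g' v) = (\<Sum>b\<in>Basis. (?g' v \<bullet> b) *\<^sub>R ?f' b)" for v
    proof -
      interpret f': linear ?f' using has_derivative_linear[OF f'] .
      have "?f' (?g' v) = ?f' (\<Sum>b\<in>Basis. (?g' v \<bullet> b) *\<^sub>R b)"
        by (simp add: euclidean_representation)
      then show ?thesis by (simp add: f'.sum f'.scaleR)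
    qed
    ultimately show "((\<lambda>x. f (g x)) has_derivative (\<lambda>v. \<Sum>b\<in>Basis.
        (frechet_derivative g (at x) v \<bullet> b) *\<^sub>R frechet_derivative f (at (g x)) b)) (at x)"
      by simp
  next
    fix v
    show "Ck_on k (\<lambda>x. \<Sum>b\<in>Basis.
        (frechet_derivative g (at x) v \<bullet> b) *\<^sub>R frechet_derivative f (at (g x)) b) S"
      using Suc.prems Ck_on_SucD[OF Suc.prems(2)]
      by (intro Ck_on_sum Ck_on_scaleR Ck_on_inner Ck_on_const Suc.IH assms(1)) auto
  qed
qed

lemma Ck_on_Un:
  assumes "open S" "open T" "Ck_on k f S" "Ck_on k f T"
  shows "Ck_on k f (S \<union> T)"
  using assms(3,4) by (induction k arbitrary: f) (auto intro: continuous_on_open_Un assms(1,2))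

lemma smooth_on_frechet_derivative:
  assumes "smooth_on f S"
  shows "smooth_on (\<lambda>x. frechet_derivative f (at x) v) S"
  using assms unfolding smooth_on_def by (metis Ck_on.simps(2))

lemma smooth_on_differentiable: "smooth_on f S \<Longrightarrow> x \<in> S \<Longrightarrow> f differentiable (at x)"
  unfolding smooth_on_def by (metis Ck_on.simps(2))


section \<open>A bump function\<close>

text \<open>The functions \<open>exp (- 1 / t) / t ^ n\<close> for \<open>t > 0\<close>, continued by 0. They are treated for
  all \<open>n\<close> together because differentiation stays within the linear span of this family.\<close>

definition flat_exp :: "nat \<Rightarrow> real \<Rightarrow> real"
  where "flat_exp n t = (if t > 0 then exp (- inverse t) * inverse t ^ n else 0)"

lemma flat_exp_tendsto_0: "(flat_exp n \<longlongrightarrow> 0) (at 0)"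
proof -
  have "((\<lambda>s. s ^ n / exp s) \<longlongrightarrow> (0::real)) at_top"
    by (rule tendsto_power_div_exp_0)
  then have "((\<lambda>t. inverse t ^ n / exp (inverse t)) \<longlongrightarrow> (0::real)) (at_right 0)"
    using filterlim_compose filterlim_inverse_at_top_right by blast
  then have "(flat_exp n \<longlongrightarrow> 0) (at_right 0)"
    by (rule Lim_transform_eventually)
      (auto intro!: eventually_mono[OF eventually_at_right_less[of 0]]
        simp: flat_exp_def exp_minus field_simps)
  moreover have "(flat_exp n \<longlongrightarrow> 0) (at_left 0)"
    by (rule Lim_transform_eventually[OF tendsto_const])
      (auto simp: eventually_at_filter flat_exp_def)
  ultimately show ?thesis by (simp add: filterlim_split_at)
qed

lemma flat_exp_has_derivative:
  "(flat_exp n has_derivative (\<lambda>v. v *\<^sub>R (flat_exp (n + 2) t + (- real n) *\<^sub>R flat_exp (n + 1) t))) (at t)"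
proof -
  have "(flat_exp n has_real_derivative (flat_exp (n + 2) t - real n * flat_exp (n + 1) t)) (at t)"
  proof (cases t "0::real" rule: linorder_cases)
    case less
    have "((\<lambda>_. 0) has_real_derivative 0) (at t)" by simp
    then have "(flat_exp n has_real_derivative 0) (at t)"
      by (rule has_field_derivative_transform_within_open[of _ _ _ "{..<0}"])
        (use less in \<open>auto simp: flat_exp_def\<close>)
    then show ?thesis using less by (simp add: flat_exp_def)
  next
    case equal
    have "((\<lambda>h. (flat_exp n (0 + h) - flat_exp n 0) / h) \<longlongrightarrow> 0) (at 0)"
      by (rule Lim_transform_eventually[OF flat_exp_tendsto_0[of "Suc n"]])
        (auto simp: flat_exp_def eventually_at divide_inverse intro!: exI[of _ 1])
    then show ?thesis using equal by (simp add: DERIV_def flat_exp_def)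
  next
    case greater
    have "((\<lambda>t. exp (- inverse t) * inverse t ^ n) has_real_derivative
        (exp (- inverse t) * inverse t ^ (n + 2) - real n * (exp (- inverse t) * inverse t ^ (n + 1)))) (at t)"
    proof -
      have inv: "(inverse has_real_derivative - (inverse t ^ 2)) (at t)"
        using DERIV_inverse[of t UNIV] greater by (simp add: power2_eq_square power_inverse)
      have exp: "((\<lambda>t. exp (- inverse t)) has_real_derivative exp (- inverse t) * inverse t ^ 2) (at t)"
        using DERIV_fun_exp[OF DERIV_minus[OF inv]] by simp
      have "exp (- inverse t) * inverse t ^ 2 * inverse t ^ n
          + real n * (- (inverse t ^ 2) * inverse t ^ (n - Suc 0)) * exp (- inverse t)
        = exp (- inverse t) * inverse t ^ (n + 2) - real n * (exp (- inverse t) * inverse t ^ (n + 1))"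
        by (cases n) (simp_all add: power2_eq_square algebra_simps)
      then show ?thesis
        using DERIV_mult[OF exp DERIV_power[OF inv, of n]] by simp
    qed
    then have "(flat_exp n has_real_derivative
        (exp (- inverse t) * inverse t ^ (n + 2) - real n * (exp (- inverse t) * inverse t ^ (n + 1)))) (at t)"
      by (rule has_field_derivative_transform_within_open[of _ _ _ "{0<..}"])
        (use greater in \<open>auto simp: flat_exp_def\<close>)
    then show ?thesis using greater by (simp add: flat_exp_def)
  qed
  then show ?thesis
    by (simp add: has_field_derivative_def mult_commute_abs)
qed

lemma Ck_on_flat_exp: "Ck_on k (flat_exp n) UNIV"
proof (induction k arbitrary: n)
  case 0
  show ?case
    using flat_exp_has_derivative
    by (auto intro!: continuous_at_imp_continuous_on has_derivative_continuous)
next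
  case (Suc k)
  show ?case
    by (rule Ck_on_SucI[OF open_UNIV flat_exp_has_derivative])
      (intro Ck_on_scaleR Ck_on_add Ck_on_const Suc.IH open_UNIV)
qed

lemma smooth_bump_exists:
  fixes a :: "'a::euclidean_space"
  assumes "r > 0"
  shows "\<exists>b :: 'a \<Rightarrow> real. (\<forall>k. Ck_on k b UNIV) \<and> b a = 1 \<and> (\<forall>x. x \<notin> cball a r \<longrightarrow> b x = 0)"
proof -
  define h where "h = (\<lambda>x. flat_exp 0 (r\<^sup>2 + (- ((x - a) \<bullet> (x - a)))))"
  have "Ck_on k (\<lambda>x. r\<^sup>2 + (- ((x + (- a)) \<bullet> (x + (- a))))) UNIV" for k
    by (intro Ck_on_add Ck_on_minus Ck_on_inner Ck_on_const Ck_on_ident open_UNIV)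
  then have "Ck_on k h UNIV" for k
    unfolding h_def by (intro Ck_on_compose[OF _ _ _ Ck_on_flat_exp]) auto
  then have smooth: "Ck_on k (\<lambda>x. inverse (h a) *\<^sub>R h x) UNIV" for k
    by (intro Ck_on_scaleR Ck_on_const) auto
  have "h a \<noteq> 0" using assms by (simp add: h_def flat_exp_def)
  moreover have "h x = 0" if "x \<notin> cball a r" for x
  proof -
    have "r < norm (x - a)" using that by (simp add: dist_norm norm_minus_commute)
    then have "r\<^sup>2 \<le> (x - a) \<bullet> (x - a)"
      using assms by (simp add: power2_norm_eq_inner[symmetric] power_mono)
    then show ?thesis by (simp add: h_def flat_exp_def)
  qed
  ultimately show ?thesis
    using smooth by (intro exI[of _ "\<lambda>x. inverse (h a) *\<^sub>R h x"]) auto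
qed

section \<open>Smooth functions and tangent vectors\<close>

lemma chart_homeomorphism:
  assumes "smooth_manifold A" "(U, \<phi>) \<in> A"
  shows "open U" "open (\<phi> ` U)" "homeomorphism U (\<phi> ` U) \<phi> (inv_into U \<phi>)" "inj_on \<phi> U"
proof -
  have "is_chart (U, \<phi>)"
    using assms by (auto simp: smooth_manifold_def)
  then show "open U" "open (\<phi> ` U)" and hom: "homeomorphism U (\<phi> ` U) \<phi> (inv_into U \<phi>)"
    by (auto simp: is_chart_def)
  show "inj_on \<phi> U"
    using hom by (metis homeomorphism_apply1 inj_on_inverseI)
qed

lemma open_chart_image:
  assumes "smooth_manifold A" "(U, \<phi>) \<in> A" "open W"
  shows "open (\<phi> ` (U \<inter> W))"
proof -
  have "openin (top_of_set (\<phi> ` U)) (\<phi> ` (U \<inter> W))"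
    using chart_homeomorphism[OF assms(1,2)] assms(3)
    by (intro homeomorphism_imp_open_map[of U "\<phi> ` U" \<phi> "inv_into U \<phi>"]) (auto simp: openin_open)
  then show ?thesis
    using chart_homeomorphism(2)[OF assms(1,2)] openin_open_trans by blast
qed

lemma chart_exists:
  assumes "smooth_manifold A"
  obtains U \<phi> where "(U, \<phi>) \<in> A" "p \<in> U"
  using assms unfolding smooth_manifold_def by blast

lemma smooth_chart_change:
  assumes "smooth_manifold A" "(U, \<phi>) \<in> A" "(V, \<psi>) \<in> A"
  shows "smooth_on (\<phi> \<circ> inv_into V \<psi>) (\<psi> ` (V \<inter> U))"
  using assms unfolding smooth_manifold_def by blast

lemma smooth_fun_iff:
  "smooth_fun A f \<longleftrightarrow> (\<forall>U \<phi> k. (U, \<phi>) \<in> A \<longrightarrow> Ck_on k (\<lambda>x. f (inv_into U \<phi> x)) (\<phi> ` U))"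
  unfolding smooth_fun_on_def smooth_on_def comp_def Int_UNIV_right by blast

lemma smooth_fun_const:
  assumes "smooth_manifold A"
  shows "smooth_fun A (\<lambda>p. c)"
  unfolding smooth_fun_iff using chart_homeomorphism(2)[OF assms] by (intro allI impI Ck_on_const)

lemma smooth_fun_add:
  assumes "smooth_manifold A" "smooth_fun A f" "smooth_fun A h"
  shows "smooth_fun A (\<lambda>p. f p + h p)"
  using assms(2,3) chart_homeomorphism(2)[OF assms(1)]
  unfolding smooth_fun_iff by (intro allI impI Ck_on_add) auto

lemma smooth_fun_cmult:
  assumes "smooth_manifold A" "smooth_fun A f"
  shows "smooth_fun A (\<lambda>p. c * f p)"
  using assms(2) chart_homeomorphism(2)[OF assms(1)]
  unfolding smooth_fun_iff real_scaleR_def[symmetric] by (intro allI impI Ck_on_scaleR Ck_on_const) auto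

lemma smooth_fun_differentiable:
  assumes "smooth_fun A f" "(U, \<phi>) \<in> A" "p \<in> U"
  shows "(f \<circ> inv_into U \<phi>) differentiable at (\<phi> p)"
  using assms by (auto simp: smooth_fun_on_def intro: smooth_on_differentiable)

text \<open>The tangent vector at \<open>p\<close> with components \<open>w\<close> in the chart \<open>(U, \<phi>)\<close>.\<close>

definition chart_vec :: "('m::topological_space, 'n::finite) chart set \<Rightarrow> 'm set \<Rightarrow> ('m \<Rightarrow> real ^ 'n) \<Rightarrow>
    'm \<Rightarrow> real ^ 'n \<Rightarrow> 'm tvec"
  where "chart_vec A U \<phi> p w = (\<lambda>f. if smooth_fun A f
    then frechet_derivative (f \<circ> inv_into U \<phi>) (at (\<phi> p)) w else 0)"

lemma linear_chart_vec:
  assumes "(U, \<phi>) \<in> A" "p \<in> U"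
  shows "linear (chart_vec A U \<phi> p)"
proof -
  have "linear (frechet_derivative (f \<circ> inv_into U \<phi>) (at (\<phi> p)))" if "smooth_fun A f" for f
    using smooth_fun_differentiable[OF that assms] by (rule linear_frechet_derivative)
  then show ?thesis
    by (intro linearI) (auto simp: chart_vec_def fun_eq_iff scaleR_fun_def linear_add linear_scale)
qed

lemma chart_vec_change:
  assumes A: "smooth_manifold A" and charts: "(U, \<phi>) \<in> A" "(V, \<psi>) \<in> A" and p: "p \<in> U" "p \<in> V"
  shows "chart_vec A V \<psi> p w =
    chart_vec A U \<phi> p (frechet_derivative (\<phi> \<circ> inv_into V \<psi>) (at (\<psi> p)) w)"
proof
  fix f
  let ?t = "\<phi> \<circ> inv_into V \<psi>"
  show "chart_vec A V \<psi> p w f = chart_vec A U \<phi> p (frechet_derivative ?t (at (\<psi> p)) w) f"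
  proof (cases "smooth_fun A f")
    case True
    let ?F = "f \<circ> inv_into U \<phi>"
    have inv: "inv_into V \<psi> (\<psi> q) = q" if "q \<in> V" for q
      using that chart_homeomorphism(4)[OF A charts(2)] by simp
    have "smooth_on ?t (\<psi> ` (V \<inter> U))"
      by (rule smooth_chart_change[OF A charts])
    then have "(?t has_derivative frechet_derivative ?t (at (\<psi> p))) (at (\<psi> p))"
      using p by (auto simp: frechet_derivative_works[symmetric] intro: smooth_on_differentiable)
    moreover have "(?F has_derivative frechet_derivative ?F (at (\<phi> p))) (at (?t (\<psi> p)))"
      using smooth_fun_differentiable[OF True charts(1) p(1)] inv[OF p(2)]
      by (simp add: frechet_derivative_works)
    ultimately have "(?F \<circ> ?t has_derivative
        frechet_derivative ?F (at (\<phi> p)) \<circ> frechet_derivative ?t (at (\<psi> p))) (at (\<psi> p))"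
      by (rule diff_chain_at)
    then have "(f \<circ> inv_into V \<psi> has_derivative
        frechet_derivative ?F (at (\<phi> p)) \<circ> frechet_derivative ?t (at (\<psi> p))) (at (\<psi> p))"
    proof (rule has_derivative_transform_within_open)
      show "open (\<psi> ` (V \<inter> U))"
        using open_chart_image[OF A charts(2)] chart_homeomorphism(1)[OF A charts(1)] by blast
      show "\<psi> p \<in> \<psi> ` (V \<inter> U)" using p by blast
      show "(?F \<circ> ?t) x = (f \<circ> inv_into V \<psi>) x" if "x \<in> \<psi> ` (V \<inter> U)" for x
        using that inv chart_homeomorphism(4)[OF A charts(1)] by auto
    qed
    from frechet_derivative_at[OF this] show ?thesis
      by (simp add: chart_vec_def True fun_eq_iff)
  qed (simp add: chart_vec_def)
qed

lemma tangent_space_eq_range: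
  assumes "smooth_manifold A" "(U, \<phi>) \<in> A" "p \<in> U"
  shows "tangent_space A p = range (chart_vec A U \<phi> p)"
proof -
  have mem: "v \<in> tangent_space A p \<longleftrightarrow> (\<exists>V \<psi> w. (V, \<psi>) \<in> A \<and> p \<in> V \<and> v = chart_vec A V \<psi> p w)" for v
    by (simp add: tangent_space_def chart_vec_def)
  show ?thesis
  proof (intro equalityI subsetI)
    fix v assume "v \<in> tangent_space A p"
    then obtain V \<psi> w where V: "(V, \<psi>) \<in> A" "p \<in> V" and v: "v = chart_vec A V \<psi> p w"
      unfolding mem by (elim exE conjE)
    show "v \<in> range (chart_vec A U \<phi> p)"
      unfolding v chart_vec_change[OF assms(1,2) V(1) assms(3) V(2)] by (rule rangeI)
  next
    fix v assume "v \<in> range (chart_vec A U \<phi> p)"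
    then obtain w where "v = chart_vec A U \<phi> p w" by (elim rangeE)
    then show "v \<in> tangent_space A p"
      unfolding mem using assms(2,3) by (intro exI conjI)
  qed
qed

lemma subspace_tangent_space:
  assumes "smooth_manifold A"
  shows "subspace (tangent_space A p)"
proof -
  obtain U \<phi> where "(U, \<phi>) \<in> A" "p \<in> U" using chart_exists[OF assms] .
  then show ?thesis
    using tangent_space_eq_range[OF assms] linear_chart_vec
    by (metis linear_subspace_image subspace_UNIV)
qed

lemma tangent_vector_linear:
  assumes "v \<in> tangent_space A p" and A: "smooth_manifold A"
  shows tangent_vector_const: "v (\<lambda>q. c) = 0"
    and tangent_vector_not_smooth: "\<not> smooth_fun A f \<Longrightarrow> v f = 0"
    and tangent_vector_add: "smooth_fun A f \<Longrightarrow> smooth_fun A h \<Longrightarrow> v (\<lambda>q. f q + h q) = v f + v h"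
    and tangent_vector_cmult: "smooth_fun A f \<Longrightarrow> v (\<lambda>q. c * f q) = c * v f"
proof -
  obtain U \<phi> w where U: "(U, \<phi>) \<in> A" "p \<in> U"
    and v: "v = (\<lambda>f. if smooth_fun A f then frechet_derivative (f \<circ> inv_into U \<phi>) (at (\<phi> p)) w else 0)"
    using assms(1) unfolding tangent_space_def by blast
  have der: "((f \<circ> inv_into U \<phi>) has_derivative frechet_derivative (f \<circ> inv_into U \<phi>) (at (\<phi> p))) (at (\<phi> p))"
    if "smooth_fun A f" for f
    using smooth_fun_differentiable[OF that U] by (simp add: frechet_derivative_works)
  show "v (\<lambda>q. c) = 0"
    using frechet_derivative_at[OF has_derivative_const[of c "at (\<phi> p)"]]
    by (simp add: v comp_def fun_eq_iff)
  show "\<not> smooth_fun A f \<Longrightarrow> v f = 0" by (simp add: v)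
  show "v (\<lambda>q. f q + h q) = v f + v h" if "smooth_fun A f" "smooth_fun A h"
    using frechet_derivative_at[OF has_derivative_add[OF der[OF that(1)] der[OF that(2)]]]
      that smooth_fun_add[OF A that] by (simp add: v comp_def fun_eq_iff)
  show "v (\<lambda>q. c * f q) = c * v f" if "smooth_fun A f"
    using frechet_derivative_at[OF has_derivative_mult_right[OF der[OF that], of c]]
      that smooth_fun_cmult[OF A that] by (simp add: v comp_def fun_eq_iff)
qed


section \<open>Vector fields\<close>

lemma vfieldsD:
  assumes "X \<in> vfields A"
  shows "X p \<in> tangent_space A p" "smooth_fun A f \<Longrightarrow> smooth_fun A (vderiv X f)"
  using assms by (auto simp: vfields_def vderiv_def)

lemma subspace_vfields:
  assumes "smooth_manifold A"
  shows "subspace (vfields A)"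
proof -
  note sub = subspace_tangent_space[OF assms]
  show ?thesis
    unfolding subspace_def
  proof (intro conjI ballI allI)
    show "0 \<in> vfields A"
      using smooth_fun_const[OF assms, of 0] subspace_0[OF sub] by (simp add: vfields_def)
    show "X + Y \<in> vfields A" if "X \<in> vfields A" "Y \<in> vfields A" for X Y
      using that smooth_fun_add[OF assms] subspace_add[OF sub] by (simp add: vfields_def)
    show "c *\<^sub>R X \<in> vfields A" if "X \<in> vfields A" for c X
      using that smooth_fun_cmult[OF assms] subspace_scale[OF sub] by (simp add: vfields_def scaleR_fun_def)
  qed
qed

lemma vderiv_add:
  assumes "smooth_manifold A" "X \<in> vfields A" "smooth_fun A f" "smooth_fun A h"
  shows "vderiv X (f + h) p = vderiv X f p + vderiv X h p"
  using tangent_vector_add[OF vfieldsD(1)[OF assms(2)] assms(1,3,4)]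
  by (simp add: vderiv_def plus_fun_def)

lemma vderiv_cmult:
  assumes "smooth_manifold A" "X \<in> vfields A" "smooth_fun A f"
  shows "vderiv X (\<lambda>q. c * f q) p = c * vderiv X f p"
  using tangent_vector_cmult[OF vfieldsD(1)[OF assms(2)] assms(1,3)] by (simp add: vderiv_def)

lemma vderiv_diff:
  assumes "smooth_manifold A" "X \<in> vfields A" "smooth_fun A f" "smooth_fun A h"
  shows "vderiv X (f - h) p = vderiv X f p - vderiv X h p"
proof -
  have "vderiv X (f - h) p = vderiv X (f + (\<lambda>q. (- 1) * h q)) p"
    by (simp add: fun_diff_def plus_fun_def)
  also have "\<dots> = vderiv X f p + vderiv X (\<lambda>q. (- 1) * h q) p"
    by (rule vderiv_add[OF assms(1-3) smooth_fun_cmult[OF assms(1,4)]])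
  also have "vderiv X (\<lambda>q. (- 1) * h q) p = (- 1) * vderiv X h p"
    by (rule vderiv_cmult[OF assms(1,2,4)])
  finally show ?thesis by (simp add: fun_diff_def)
qed

lemma vderiv_const: "smooth_manifold A \<Longrightarrow> X \<in> vfields A \<Longrightarrow> vderiv X (\<lambda>q. c) = (\<lambda>p. 0)"
  using tangent_vector_const vfieldsD(1) by (force simp: vderiv_def)

lemma lie_bracket_apply: "vderiv (lie_bracket X Y) f = vderiv X (vderiv Y f) - vderiv Y (vderiv X f)"
  by (simp add: vderiv_def lie_bracket_def fun_diff_def)

lemma lie_bracket_skew: "lie_bracket Y X = - lie_bracket X Y"
  by (simp add: lie_bracket_def fun_eq_iff)

text \<open>Tangent vectors are 0 on functions that are not smooth, so brackets are, too.\<close>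

lemma lie_bracket_not_smooth:
  assumes "smooth_manifold A" "X \<in> vfields A" "Y \<in> vfields A" "\<not> smooth_fun A f"
  shows "lie_bracket X Y p f = 0"
proof -
  have "vderiv Z f = (\<lambda>p. 0)" if "Z \<in> vfields A" for Z
    using tangent_vector_not_smooth[OF vfieldsD(1)[OF that] assms(1,4)] by (simp add: vderiv_def)
  then show ?thesis
    using assms vderiv_const[OF assms(1), of _ 0] by (simp add: lie_bracket_def)
qed

lemma lie_bracket_linear_left:
  assumes A: "smooth_manifold A" and XY: "X \<in> vfields A" "X' \<in> vfields A" "Y \<in> vfields A"
  shows lie_bracket_add_left: "lie_bracket (X + X') Y = lie_bracket X Y + lie_bracket X' Y"
    and lie_bracket_scale_left: "lie_bracket (c *\<^sub>R X) Y = c *\<^sub>R lie_bracket X Y"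
proof -
  have sum: "vderiv (X + X') f = vderiv X f + vderiv X' f" for f
    by (simp add: vderiv_def plus_fun_def)
  have scale: "vderiv (c *\<^sub>R X) f = (\<lambda>p. c * vderiv X f p)" for f
    by (simp add: vderiv_def scaleR_fun_def)
  have mem: "X + X' \<in> vfields A" "c *\<^sub>R X \<in> vfields A"
    using XY by (auto intro: subspace_add subspace_scale subspace_vfields[OF A])
  show "lie_bracket (X + X') Y = lie_bracket X Y + lie_bracket X' Y"
  proof (intro ext)
    fix p f
    show "lie_bracket (X + X') Y p f = (lie_bracket X Y + lie_bracket X' Y) p f"
    proof (cases "smooth_fun A f")
      case True
      then show ?thesis
        using XY by (simp add: lie_bracket_def sum vderiv_add[OF A] vfieldsD)
    next
      case False
      then show ?thesis
        using XY mem by (simp add: lie_bracket_not_smooth[OF A])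
    qed
  qed
  show "lie_bracket (c *\<^sub>R X) Y = c *\<^sub>R lie_bracket X Y"
  proof (intro ext)
    fix p f
    show "lie_bracket (c *\<^sub>R X) Y p f = (c *\<^sub>R lie_bracket X Y) p f"
    proof (cases "smooth_fun A f")
      case True
      then show ?thesis
        using XY by (simp add: lie_bracket_def scale vderiv_cmult[OF A] vfieldsD right_diff_distrib)
          (simp add: scaleR_fun_def right_diff_distrib)
    next
      case False
      then show ?thesis
        using XY mem by (simp add: lie_bracket_not_smooth[OF A] scaleR_fun_def)
    qed
  qed
qed

lemma jacobi_identity:
  assumes A: "smooth_manifold A" and X: "X \<in> vfields A" and Y: "Y \<in> vfields A" and Z: "Z \<in> vfields A"
    and brackets: "lie_bracket X Y \<in> vfields A" "lie_bracket Y Z \<in> vfields A" "lie_bracket Z X \<in> vfields A"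
  shows "lie_bracket X (lie_bracket Y Z) + lie_bracket Y (lie_bracket Z X)
    + lie_bracket Z (lie_bracket X Y) = 0"
proof (intro ext)
  fix p f
  show "(lie_bracket X (lie_bracket Y Z) + lie_bracket Y (lie_bracket Z X)
    + lie_bracket Z (lie_bracket X Y)) p f = 0 p f"
  proof (cases "smooth_fun A f")
    case True
    have expand: "lie_bracket P (lie_bracket Q R) p f =
        vderiv P (vderiv Q (vderiv R f)) p - vderiv P (vderiv R (vderiv Q f)) p
        - (vderiv Q (vderiv R (vderiv P f)) p - vderiv R (vderiv Q (vderiv P f)) p)"
      if "P \<in> vfields A" "Q \<in> vfields A" "R \<in> vfields A" for P Q R
    proof -
      have "lie_bracket P (lie_bracket Q R) p f =
          vderiv P (vderiv Q (vderiv R f) - vderiv R (vderiv Q f)) p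
          - (vderiv Q (vderiv R (vderiv P f)) - vderiv R (vderiv Q (vderiv P f))) p"
        unfolding lie_bracket_apply[symmetric] by (simp add: lie_bracket_def vderiv_def)
      then show ?thesis
        using that True by (simp add: vderiv_diff[OF A] vfieldsD)
    qed
    show ?thesis by (simp add: expand X Y Z)
  next
    case False
    then show ?thesis using lie_bracket_not_smooth[OF A] X Y Z brackets by simp
  qed
qed

text \<open>Every tangent vector is the value of a global vector field: the constant field in a chart,
  multiplied by a bump function. The Hausdorff property enters because the compact support
  has to be closed in the whole manifold.\<close>

lemma vfield_extension:
  fixes A :: "('m::{t2_space,second_countable_topology}, 'n::finite) chart set"
  assumes A: "smooth_manifold A" and v: "v \<in> tangent_space A p"
  shows "\<exists>X\<in>vfields A. X p = v"
proof -
  obtain U \<phi> where U: "(U, \<phi>) \<in> A" "p \<in> U" using chart_exists[OF A] .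
  note hom = chart_homeomorphism[OF A U(1)]
  obtain w where w: "v = chart_vec A U \<phi> p w"
    using v tangent_space_eq_range[OF A U] by blast
  obtain r where r: "r > 0" "cball (\<phi> p) r \<subseteq> \<phi> ` U"
    using hom(2) U(2) open_contains_cball by blast
  obtain b :: "real ^ 'n \<Rightarrow> real" where b: "\<And>k. Ck_on k b UNIV" "b (\<phi> p) = 1"
    "\<And>x. x \<notin> cball (\<phi> p) r \<Longrightarrow> b x = 0"
    using smooth_bump_exists[OF r(1)] by blast
  define C where "C = inv_into U \<phi> ` cball (\<phi> p) r"
  have "compact C"
    unfolding C_def using hom(3) r(2)
    by (intro compact_continuous_image) (auto simp: homeomorphism_def intro: continuous_on_subset)
  then have "closed C" by (rule compact_imp_closed)
  have C: "\<phi> q \<notin> cball (\<phi> p) r" if "q \<in> U" "q \<notin> C" for q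
  proof
    assume "\<phi> q \<in> cball (\<phi> p) r"
    then have "inv_into U \<phi> (\<phi> q) \<in> C" unfolding C_def by (rule imageI)
    then show False using that hom(4) by simp
  qed
  have "C \<subseteq> U"
    unfolding C_def using r(2) by (auto intro: inv_into_into)
  define X where "X = (\<lambda>q. if q \<in> U then b (\<phi> q) *\<^sub>R chart_vec A U \<phi> q w else 0)"
  have "X \<in> vfields A"
    unfolding vfields_def mem_Collect_eq
  proof (intro conjI allI impI)
    fix q
    note sub = subspace_tangent_space[OF A, of q]
    have "chart_vec A U \<phi> q w \<in> tangent_space A q" if "q \<in> U"
      using tangent_space_eq_range[OF A U(1) that] by blast
    then show "X q \<in> tangent_space A q"
      by (auto simp: X_def intro: subspace_0[OF sub] subspace_scale[OF sub])
  next
    fix f assume f: "smooth_fun A f"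
    define G where "G = (\<lambda>x. b x *\<^sub>R frechet_derivative (f \<circ> inv_into U \<phi>) (at x) w)"
    have XG: "X q f = G (\<phi> q)" if "q \<in> U" for q
      using that f by (simp add: X_def G_def chart_vec_def scaleR_fun_def)
    have X0: "X q f = 0" if "q \<notin> C" for q
      using b(3) C[OF _ that] by (simp add: X_def scaleR_fun_def zero_fun_def)
    have G: "Ck_on k G (\<phi> ` U)" for k
      unfolding G_def
    proof (intro Ck_on_scaleR hom(2))
      show "Ck_on k b (\<phi> ` U)" using b(1) by (rule Ck_on_subset) simp
      have "smooth_on (f \<circ> inv_into U \<phi>) (\<phi> ` U)"
        using f U(1) unfolding smooth_fun_on_def Int_UNIV_right by blast
      from smooth_on_frechet_derivative[OF this]
      show "Ck_on k (\<lambda>x. frechet_derivative (f \<circ> inv_into U \<phi>) (at x) w) (\<phi> ` U)"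
        by (simp add: smooth_on_def)
    qed
    show "smooth_fun A (\<lambda>q. X q f)"
      unfolding smooth_fun_iff
    proof (intro allI impI)
      fix V \<psi> k assume V: "(V, \<psi>) \<in> A"
      have inv: "inv_into V \<psi> (\<psi> q) = q" if "q \<in> V" for q
        using that chart_homeomorphism(4)[OF A V] by simp
      \<comment> \<open>The manifold is covered by \<open>U\<close> and by the complement of the support.\<close>
      have op: "open (\<psi> ` (V \<inter> U))" "open (\<psi> ` (V \<inter> - C))"
        using open_chart_image[OF A V] hom(1) \<open>closed C\<close> by auto
      have "smooth_on (\<phi> \<circ> inv_into V \<psi>) (\<psi> ` (V \<inter> U))"
        by (rule smooth_chart_change[OF A U(1) V])
      then have "Ck_on k (\<lambda>x. \<phi> (inv_into V \<psi> x)) (\<psi> ` (V \<inter> U))"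
        by (simp add: smooth_on_def comp_def)
      then have "Ck_on k (\<lambda>x. G (\<phi> (inv_into V \<psi> x))) (\<psi> ` (V \<inter> U))"
        using inv by (intro Ck_on_compose[OF op(1) hom(2) _ G]) auto
      then have "Ck_on k (\<lambda>x. X (inv_into V \<psi> x) f) (\<psi> ` (V \<inter> U))"
        by (rule Ck_on_cong[OF op(1), THEN iffD1, rotated]) (auto simp: inv XG)
      moreover have "Ck_on k (\<lambda>x. X (inv_into V \<psi> x) f) (\<psi> ` (V \<inter> - C))"
        by (rule Ck_on_cong[OF op(2), THEN iffD1, rotated, OF Ck_on_const[OF op(2), of _ 0]])
          (auto simp: inv X0)
      ultimately have "Ck_on k (\<lambda>x. X (inv_into V \<psi> x) f) (\<psi> ` (V \<inter> U) \<union> \<psi> ` (V \<inter> - C))"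
        using Ck_on_Un op by blast
      moreover have "\<psi> ` (V \<inter> U) \<union> \<psi> ` (V \<inter> - C) = \<psi> ` V"
        using \<open>C \<subseteq> U\<close> by blast
      ultimately show "Ck_on k (\<lambda>x. X (inv_into V \<psi> x) f) (\<psi> ` V)" by simp
    qed
  qed
  moreover have "X p = v" using U(2) b(2) w by (simp add: X_def)
  ultimately show ?thesis by blast
qed

section \<open>Metric connections\<close>

text \<open>Closure of the vector fields under brackets is an assumption here; for a pair of connections
  with opposite torsions it follows from their closure properties.\<close>

locale metric_connection =
  fixes A :: "('m::{t2_space,second_countable_topology}, 'n::finite) chart set"
    and g :: "'m bilin" and D :: "'m connection"
  assumes manifold: "smooth_manifold A"
    and metric: "riemannian_metric A g"
    and conn: "linear_connection A D"
    and parallel: "parallel_metric A D g"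
    and bracket_closed: "X \<in> vfields A \<Longrightarrow> Y \<in> vfields A \<Longrightarrow> lie_bracket X Y \<in> vfields A"
begin

abbreviation "VF \<equiv> vfields A"

lemmas vf_add = subspace_add[OF subspace_vfields[OF manifold]]
  and vf_diff = subspace_diff[OF subspace_vfields[OF manifold]]
  and vf_minus = subspace_neg[OF subspace_vfields[OF manifold]]
  and vf_scale = subspace_scale[OF subspace_vfields[OF manifold]]
  and vf_tangent = vfieldsD(1)

lemma g_add_left:
  "u \<in> tangent_space A p \<Longrightarrow> v \<in> tangent_space A p \<Longrightarrow> w \<in> tangent_space A p \<Longrightarrow>
    g p (u + v) w = g p u w + g p v w"
  using metric by (simp add: riemannian_metric_def)

lemma g_scale_left:
  "u \<in> tangent_space A p \<Longrightarrow> w \<in> tangent_space A p \<Longrightarrow> g p (c *\<^sub>R u) w = c * g p u w"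
  using metric by (simp add: riemannian_metric_def)

lemma g_sym: "u \<in> tangent_space A p \<Longrightarrow> v \<in> tangent_space A p \<Longrightarrow> g p u v = g p v u"
  using metric by (simp add: riemannian_metric_def)

lemma g_definite:
  assumes "u \<in> tangent_space A p" "g p u u = 0"
  shows "u = 0"
proof -
  have "u \<noteq> 0 \<longrightarrow> g p u u > 0"
    using metric assms(1) unfolding riemannian_metric_def by blast
  then show ?thesis using assms(2) by linarith
qed

lemma smooth_gval: "X \<in> VF \<Longrightarrow> Y \<in> VF \<Longrightarrow> smooth_fun A (gval g X Y)"
  using metric by (simp add: riemannian_metric_def)

lemma gval_sym: "X \<in> VF \<Longrightarrow> Y \<in> VF \<Longrightarrow> gval g X Y p = gval g Y X p"
  by (simp add: gval_def g_sym vf_tangent)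

lemma gval_add_left:
  "X \<in> VF \<Longrightarrow> Y \<in> VF \<Longrightarrow> Z \<in> VF \<Longrightarrow> gval g (X + Y) Z p = gval g X Z p + gval g Y Z p"
  by (simp add: gval_def g_add_left vf_tangent)

lemma gval_scale_left:
  "X \<in> VF \<Longrightarrow> Y \<in> VF \<Longrightarrow> gval g (c *\<^sub>R X) Y p = c * gval g X Y p"
  using g_scale_left[of "X p" p "Y p" c] vf_tangent by (auto simp: gval_def scaleR_fun_def)

lemma gval_minus_left: "X \<in> VF \<Longrightarrow> Y \<in> VF \<Longrightarrow> gval g (- X) Y p = - gval g X Y p"
  using gval_scale_left[of X Y "-1"] by simp

lemma gval_diff_left:
  "X \<in> VF \<Longrightarrow> Y \<in> VF \<Longrightarrow> Z \<in> VF \<Longrightarrow> gval g (X - Y) Z p = gval g X Z p - gval g Y Z p"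
  using gval_add_left[of X "- Y" Z p] by (simp add: gval_minus_left vf_minus)

lemma gval_right:
  assumes "X \<in> VF" "Y \<in> VF" "Z \<in> VF"
  shows gval_add_right: "gval g Z (X + Y) p = gval g Z X p + gval g Z Y p"
    and gval_diff_right: "gval g Z (X - Y) p = gval g Z X p - gval g Z Y p"
    and gval_scale_right: "gval g Z (c *\<^sub>R X) p = c * gval g Z X p"
  using assms
  by (simp_all add: gval_sym[of Z] vf_add vf_diff vf_scale gval_add_left gval_diff_left
      gval_scale_left)

lemma gval_zero_right:
  assumes "X \<in> VF" "Y \<in> VF" "Y p = 0"
  shows "gval g X Y p = 0"
proof -
  have "gval g X Y p = g p (Y p) (X p)"
    using gval_sym[OF assms(1,2)] by (simp add: gval_def)
  also have "\<dots> = 0"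
    using g_scale_left[of "Y p" p "X p" 0] vf_tangent[OF assms(1), of p] vf_tangent[OF assms(2), of p]
      assms(3) by simp
  finally show ?thesis .
qed

lemma gval_eqI:
  assumes "X \<in> VF" "Y \<in> VF" "\<And>Z p. Z \<in> VF \<Longrightarrow> gval g X Z p = gval g Y Z p"
  shows "X = Y"
proof
  fix p
  have "gval g (X - Y) (X - Y) p = 0"
    using assms by (simp add: gval_diff_left vf_diff)
  then have "(X - Y) p = 0"
    unfolding gval_def using assms vf_diff vf_tangent by (blast intro: g_definite)
  then show "X p = Y p" by simp
qed

lemma D_closed: "X \<in> VF \<Longrightarrow> Y \<in> VF \<Longrightarrow> D X Y \<in> VF"
  using conn by (simp add: linear_connection_def)

lemma D_add_left: "X \<in> VF \<Longrightarrow> X' \<in> VF \<Longrightarrow> Y \<in> VF \<Longrightarrow> D (X + X') Y = D X Y + D X' Y"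
  using conn by (simp add: linear_connection_def)

lemma D_add_right: "X \<in> VF \<Longrightarrow> Y \<in> VF \<Longrightarrow> Y' \<in> VF \<Longrightarrow> D X (Y + Y') = D X Y + D X Y'"
  using conn by (simp add: linear_connection_def)

lemma fmul_const: "fmul (\<lambda>p. c) X = c *\<^sub>R X"
  by (simp add: fmul_def scaleR_fun_def)

lemma D_scale_left: "X \<in> VF \<Longrightarrow> Y \<in> VF \<Longrightarrow> D (c *\<^sub>R X) Y = c *\<^sub>R D X Y"
  using conn smooth_fun_const[OF manifold, of c]
  unfolding linear_connection_def fmul_const[symmetric] by blast

lemma D_scale_right:
  assumes "X \<in> VF" "Y \<in> VF"
  shows "D X (c *\<^sub>R Y) = c *\<^sub>R D X Y"
proof -
  have "D X (fmul (\<lambda>p. c) Y) = fmul (vderiv X (\<lambda>p. c)) Y + fmul (\<lambda>p. c) (D X Y)"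
    using conn smooth_fun_const[OF manifold, of c] assms
    unfolding linear_connection_def by blast
  then show ?thesis
    by (simp add: fmul_const vderiv_const[OF manifold assms(1)])
qed

lemma D_minus_right: "X \<in> VF \<Longrightarrow> Y \<in> VF \<Longrightarrow> D X (- Y) = - D X Y"
  using D_scale_right[of X Y "-1"] by simp

lemma D_diff_right: "X \<in> VF \<Longrightarrow> Y \<in> VF \<Longrightarrow> Y' \<in> VF \<Longrightarrow> D X (Y - Y') = D X Y - D X Y'"
  using D_add_right[of X Y "- Y'"] by (simp add: D_minus_right vf_minus)

lemma torsion_closed: "X \<in> VF \<Longrightarrow> Y \<in> VF \<Longrightarrow> torsion D X Y \<in> VF"
  by (simp add: torsion_def D_closed bracket_closed vf_diff)

lemma torsion_skew: "torsion D Y X = - torsion D X Y"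
  by (simp add: torsion_def lie_bracket_skew[of Y X])

lemma bracket_eq: "lie_bracket X Y = D X Y - D Y X - torsion D X Y"
  by (simp add: torsion_def)

lemma curvature_closed: "X \<in> VF \<Longrightarrow> Y \<in> VF \<Longrightarrow> Z \<in> VF \<Longrightarrow> curvature D X Y Z \<in> VF"
  by (simp add: curvature_def D_closed bracket_closed vf_diff)

lemma curvature4_expand:
  "X \<in> VF \<Longrightarrow> Y \<in> VF \<Longrightarrow> Z \<in> VF \<Longrightarrow> V \<in> VF \<Longrightarrow> curvature4 g D X Y Z V p =
    gval g (D X (D Y Z)) V p - gval g (D Y (D X Z)) V p - gval g (D (lie_bracket X Y) Z) V p"
  by (simp add: curvature4_def curvature_def gval_diff_left D_closed bracket_closed vf_diff)

lemma compat_fun: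
  assumes "X \<in> VF" "Y \<in> VF" "Z \<in> VF"
  shows "vderiv X (gval g Y Z) = gval g (D X Y) Z + gval g Y (D X Z)"
proof -
  have "vderiv X (gval g Y Z) - gval g (D X Y) Z - gval g Y (D X Z) = 0"
    using parallel assms by (simp add: parallel_metric_def)
  then show ?thesis by (simp add: algebra_simps)
qed

lemma compat:
  "X \<in> VF \<Longrightarrow> Y \<in> VF \<Longrightarrow> Z \<in> VF \<Longrightarrow>
    vderiv X (gval g Y Z) p = gval g (D X Y) Z p + gval g Y (D X Z) p"
  by (simp add: compat_fun)

lemma curvature4_skew_12:
  assumes "X \<in> VF" "Y \<in> VF" "Z \<in> VF" "V \<in> VF"
  shows "curvature4 g D X Y Z V p = - curvature4 g D Y X Z V p"
proof -
  have "D (lie_bracket Y X) Z = - D (lie_bracket X Y) Z"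
    using D_scale_left[of "lie_bracket X Y" Z "-1"] assms
    by (simp add: lie_bracket_skew[of Y X] bracket_closed)
  then show ?thesis
    using assms by (simp add: curvature4_expand gval_minus_left D_closed bracket_closed)
qed

lemma curvature4_skew_34:
  assumes "X \<in> VF" "Y \<in> VF" "Z \<in> VF" "V \<in> VF"
  shows "curvature4 g D X Y Z V p = - curvature4 g D X Y V Z p"
proof -
  have second: "vderiv P (vderiv Q (gval g Z V)) p =
      gval g (D P (D Q Z)) V p + gval g (D Q Z) (D P V) p
      + gval g (D P Z) (D Q V) p + gval g Z (D P (D Q V)) p"
    if "P \<in> VF" "Q \<in> VF" for P Q
    using that assms
    by (simp add: compat_fun vderiv_add[OF manifold] smooth_gval D_closed)
  have "vderiv (lie_bracket X Y) (gval g Z V) p =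
      vderiv X (vderiv Y (gval g Z V)) p - vderiv Y (vderiv X (gval g Z V)) p"
    by (simp add: lie_bracket_apply)
  then show ?thesis
    using assms
    by (simp add: second curvature4_expand compat bracket_closed D_closed gval_sym[of Z])
qed

text \<open>That the curvature is pointwise in its last two slots needs no locality of the connection:
  it is so in the last slot by definition, and skew-symmetry moves this to the third.\<close>

lemma curvature4_zero_34:
  assumes "X \<in> VF" "Y \<in> VF" "Z \<in> VF" "V \<in> VF" "Z p = 0 \<or> V p = 0"
  shows "curvature4 g D X Y Z V p = 0"
proof -
  have "curvature4 g D X Y P Q p = 0" if "P \<in> VF" "Q \<in> VF" "Q p = 0" for P Q
    using that assms(1,2) by (simp add: curvature4_def gval_zero_right curvature_closed)
  then show ?thesis
    using assms curvature4_skew_34[OF assms(1-4), of p] by fastforce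
qed

lemma curvature4_linear_4:
  assumes "X \<in> VF" "Y \<in> VF" "Z \<in> VF" "V \<in> VF" "V' \<in> VF"
  shows "curvature4 g D X Y Z (V + V') p = curvature4 g D X Y Z V p + curvature4 g D X Y Z V' p"
    and "curvature4 g D X Y Z (c *\<^sub>R V) p = c * curvature4 g D X Y Z V p"
  using assms by (simp_all add: curvature4_def gval_right[where X = V] curvature_closed)

lemma curvature4_linear_3:
  assumes "X \<in> VF" "Y \<in> VF" "Z \<in> VF" "V \<in> VF" "V' \<in> VF"
  shows "curvature4 g D X Y (V + V') Z p = curvature4 g D X Y V Z p + curvature4 g D X Y V' Z p"
    and "curvature4 g D X Y (c *\<^sub>R V) Z p = c * curvature4 g D X Y V Z p"
  using curvature4_linear_4[OF assms] assms
  by (simp_all add: curvature4_skew_34[of X Y _ Z] vf_add vf_scale)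

lemma curvature4_cong_34:
  assumes "X \<in> VF" "Y \<in> VF" "Z \<in> VF" "Z' \<in> VF" "V \<in> VF" "V' \<in> VF" "Z p = Z' p" "V p = V' p"
  shows "curvature4 g D X Y Z V p = curvature4 g D X Y Z' V' p"
proof -
  have "curvature4 g D X Y (Z' + (Z - Z')) V p = curvature4 g D X Y Z' V p"
    using assms by (subst curvature4_linear_3) (simp_all add: vf_diff curvature4_zero_34)
  moreover have "curvature4 g D X Y Z' (V' + (V - V')) p = curvature4 g D X Y Z' V' p"
    using assms by (subst curvature4_linear_4) (simp_all add: vf_diff curvature4_zero_34)
  ultimately show ?thesis by simp
qed

lemma curvature4_linear_1:
  assumes "X \<in> VF" "X' \<in> VF" "Y \<in> VF" "Z \<in> VF" "V \<in> VF"
  shows "curvature4 g D (X + X') Y Z V p = curvature4 g D X Y Z V p + curvature4 g D X' Y Z V p"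
    and "curvature4 g D (c *\<^sub>R X) Y Z V p = c * curvature4 g D X Y Z V p"
  using assms
  by (simp_all add: curvature4_expand vf_add vf_scale D_add_left D_scale_left D_add_right D_scale_right
      D_closed bracket_closed gval_add_left gval_scale_left right_diff_distrib
      lie_bracket_add_left[OF manifold] lie_bracket_scale_left[OF manifold assms(1,2)])

text \<open>A parallel 3-form is annihilated by the curvature acting as a derivation.\<close>

lemma curvature_parallel_3form:
  assumes par: "parallel_3form A D \<omega>"
    and smooth: "\<And>X Y Z. X \<in> VF \<Longrightarrow> Y \<in> VF \<Longrightarrow> Z \<in> VF \<Longrightarrow> smooth_fun A (\<omega> X Y Z)"
    and diff: "\<And>X X' Y Z. X \<in> VF \<Longrightarrow> X' \<in> VF \<Longrightarrow> Y \<in> VF \<Longrightarrow> Z \<in> VF \<Longrightarrow>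
      \<omega> (X - X') Y Z = \<omega> X Y Z - \<omega> X' Y Z \<and> \<omega> Y (X - X') Z = \<omega> Y X Z - \<omega> Y X' Z
      \<and> \<omega> Y Z (X - X') = \<omega> Y Z X - \<omega> Y Z X'"
    and mem: "X \<in> VF" "Y \<in> VF" "U \<in> VF" "V \<in> VF" "W \<in> VF"
  shows "\<omega> (curvature D X Y U) V W p + \<omega> U (curvature D X Y V) W p + \<omega> U V (curvature D X Y W) p = 0"
proof -
  have first: "vderiv P (\<omega> U V W) = \<omega> (D P U) V W + \<omega> U (D P V) W + \<omega> U V (D P W)"
    if "P \<in> VF" "U \<in> VF" "V \<in> VF" "W \<in> VF" for P U V W
  proof -
    have "vderiv P (\<omega> U V W) - \<omega> (D P U) V W - \<omega> U (D P V) W - \<omega> U V (D P W) = 0"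
      using par that by (simp add: parallel_3form_def)
    then show ?thesis by (simp add: algebra_simps)
  qed
  have second: "vderiv P (vderiv Q (\<omega> U V W)) p =
      \<omega> (D P (D Q U)) V W p + \<omega> U (D P (D Q V)) W p + \<omega> U V (D P (D Q W)) p
      + (\<omega> (D Q U) (D P V) W p + \<omega> (D P U) (D Q V) W p)
      + (\<omega> (D Q U) V (D P W) p + \<omega> (D P U) V (D Q W) p)
      + (\<omega> U (D Q V) (D P W) p + \<omega> U (D P V) (D Q W) p)"
    if "P \<in> VF" "Q \<in> VF" for P Q
  proof -
    let ?a = "\<omega> (D Q U) V W" and ?b = "\<omega> U (D Q V) W" and ?c = "\<omega> U V (D Q W)"
    have sm: "smooth_fun A ?a" "smooth_fun A ?b" "smooth_fun A ?c"
      using that mem by (simp_all add: smooth D_closed)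
    have sm_ab: "smooth_fun A (?a + ?b)"
      using smooth_fun_add[OF manifold sm(1,2)] by (simp add: plus_fun_def)
    have "vderiv P (vderiv Q (\<omega> U V W)) p = vderiv P (?a + ?b + ?c) p"
      by (simp only: first[OF that(2) mem(3-5)])
    also have "\<dots> = vderiv P ?a p + vderiv P ?b p + vderiv P ?c p"
      by (simp only: vderiv_add[OF manifold that(1) sm_ab sm(3)] vderiv_add[OF manifold that(1) sm(1,2)])
    also have "vderiv P ?a = \<omega> (D P (D Q U)) V W + \<omega> (D Q U) (D P V) W + \<omega> (D Q U) V (D P W)"
      using that mem by (intro first D_closed)
    also have "vderiv P ?b = \<omega> (D P U) (D Q V) W + \<omega> U (D P (D Q V)) W + \<omega> U (D Q V) (D P W)"
      using that mem by (intro first D_closed)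
    also have "vderiv P ?c = \<omega> (D P U) V (D Q W) + \<omega> U (D P V) (D Q W) + \<omega> U V (D P (D Q W))"
      using that mem by (intro first D_closed)
    finally show ?thesis by simp
  qed
  have bracket: "vderiv (lie_bracket X Y) (\<omega> U V W) p =
      vderiv X (vderiv Y (\<omega> U V W)) p - vderiv Y (vderiv X (\<omega> U V W)) p"
    by (simp add: lie_bracket_apply)
  have bracket': "vderiv (lie_bracket X Y) (\<omega> U V W) p = \<omega> (D (lie_bracket X Y) U) V W p
      + \<omega> U (D (lie_bracket X Y) V) W p + \<omega> U V (D (lie_bracket X Y) W) p"
    using first[OF bracket_closed[OF mem(1,2)] mem(3-5)] by simp
  note closed = mem D_closed bracket_closed vf_diff
  have "\<omega> (curvature D X Y U) V W p = \<omega> (D X (D Y U)) V W p - \<omega> (D Y (D X U)) V W p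
      - \<omega> (D (lie_bracket X Y) U) V W p"
    unfolding curvature_def by (simp add: diff closed)
  moreover have "\<omega> U (curvature D X Y V) W p = \<omega> U (D X (D Y V)) W p - \<omega> U (D Y (D X V)) W p
      - \<omega> U (D (lie_bracket X Y) V) W p"
    unfolding curvature_def by (simp add: diff closed)
  moreover have "\<omega> U V (curvature D X Y W) p = \<omega> U V (D X (D Y W)) p - \<omega> U V (D Y (D X W)) p
      - \<omega> U V (D (lie_bracket X Y) W) p"
    unfolding curvature_def by (simp add: diff closed)
  ultimately show ?thesis
    using second[OF mem(1,2)] second[OF mem(2,1)] bracket bracket' by linarith
qed

end


section \<open>Two metric connections with opposite torsion\<close>

text \<open>The connection \<open>D\<close> has totally skew torsion \<open>T\<close>, and \<open>Dh\<close> is the Hull connection of \<open>D\<close>.\<close>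

locale opposite_torsion = metric_connection A g D + H: metric_connection A g Dh
  for A :: "('m::{t2_space,second_countable_topology}, 'n::finite) chart set"
    and g :: "'m bilin" and D Dh :: "'m connection" +
  assumes skew: "totally_skew A (torsion_form g D)"
    and opposite: "X \<in> VF \<Longrightarrow> Y \<in> VF \<Longrightarrow> torsion Dh X Y = - torsion D X Y"
begin

abbreviation "\<tau> \<equiv> torsion D"
abbreviation "T \<equiv> torsion_form g D"

lemma T_skew_12: "X \<in> VF \<Longrightarrow> Y \<in> VF \<Longrightarrow> Z \<in> VF \<Longrightarrow> T X Y Z = - T Y X Z"
  and T_skew_23: "X \<in> VF \<Longrightarrow> Y \<in> VF \<Longrightarrow> Z \<in> VF \<Longrightarrow> T X Y Z = - T X Z Y"
  using skew unfolding totally_skew_def by blast+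

lemma T_eq: "gval g (\<tau> X Y) Z = T X Y Z"
  by (simp add: torsion_form_def)

lemma T_cyclic: "X \<in> VF \<Longrightarrow> Y \<in> VF \<Longrightarrow> Z \<in> VF \<Longrightarrow> T X Y Z = T Y Z X"
  using T_skew_12[of X Y Z] T_skew_23[of Y X Z] by simp

lemma smooth_T: "X \<in> VF \<Longrightarrow> Y \<in> VF \<Longrightarrow> Z \<in> VF \<Longrightarrow> smooth_fun A (T X Y Z)"
  unfolding torsion_form_def by (intro smooth_gval torsion_closed)

lemma T_bracket_3:
  assumes "X \<in> VF" "Y \<in> VF" "Z \<in> VF" "V \<in> VF"
  shows "T X Y (lie_bracket Z V) p = T X Y (D Z V) p - T X Y (D V Z) p - T X Y (\<tau> Z V) p"
  using assms by (simp add: T_eq[symmetric] bracket_eq[of Z V] gval_diff_right torsion_closed D_closed vf_diff)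

lemma T_bracket_1:
  assumes "X \<in> VF" "Y \<in> VF" "Z \<in> VF" "V \<in> VF"
  shows "T (lie_bracket Z V) X Y p = T (D Z V) X Y p - T (D V Z) X Y p - T X Y (\<tau> Z V) p"
  using T_bracket_3[OF assms, of p] assms
  by (simp add: T_cyclic[of "lie_bracket Z V"] T_cyclic[of "D _ _"] D_closed bracket_closed)

text \<open>Koszul argument: \<open>D - \<tau>\<close> is a metric connection with the torsion of \<open>Dh\<close>. A difference of metric
  connections is skew in its last two slots, and equal torsions make it symmetric in its first
  two, so it vanishes.\<close>

lemma Dh_eq:
  assumes X: "X \<in> VF" and Y: "Y \<in> VF"
  shows "Dh X Y = D X Y - \<tau> X Y"
proof (rule gval_eqI)
  show "Dh X Y \<in> VF" "D X Y - \<tau> X Y \<in> VF"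
    using X Y by (auto intro: D_closed H.D_closed torsion_closed vf_diff)
  define B where "B = (\<lambda>X Y Z p. gval g (Dh X Y) Z p - gval g (D X Y) Z p + T X Y Z p)"
  have symm: "B X Y Z p = B Y X Z p" if "X \<in> VF" "Y \<in> VF" "Z \<in> VF" for X Y Z p
  proof -
    have "Dh X Y - Dh Y X - lie_bracket X Y = - (D X Y - D Y X - lie_bracket X Y)"
      using opposite[OF that(1,2)] by (simp add: torsion_def)
    then have "Dh X Y - Dh Y X = (D X Y - D Y X) - 2 *\<^sub>R \<tau> X Y"
      by (simp add: torsion_def algebra_simps scaleR_2)
    then have "gval g (Dh X Y - Dh Y X) Z p = gval g ((D X Y - D Y X) - 2 *\<^sub>R \<tau> X Y) Z p"
      by simp
    then have "gval g (Dh X Y) Z p - gval g (Dh Y X) Z p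
        = gval g (D X Y) Z p - gval g (D Y X) Z p - 2 * T X Y Z p"
      using that by (simp add: gval_diff_left gval_scale_left H.D_closed D_closed torsion_closed
          vf_diff vf_scale T_eq)
    then show ?thesis
      using T_skew_12[OF that] by (simp add: B_def)
  qed
  have antisym: "B X Y Z p = - B X Z Y p" if "X \<in> VF" "Y \<in> VF" "Z \<in> VF" for X Y Z p
    using compat[OF that, of p] H.compat[OF that, of p] T_skew_23[OF that] that
    by (simp add: B_def gval_sym[of Y] D_closed H.D_closed)
  show "gval g (Dh X Y) Z p = gval g (D X Y - \<tau> X Y) Z p" if Z: "Z \<in> VF" for Z p
  proof -
    have "B X Y Z p = 0"
      using symm[OF X Y Z, of p] antisym[OF Y X Z, of p] symm[OF Y Z X, of p] antisym[OF Z Y X, of p]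
        symm[OF Z X Y, of p] antisym[OF X Z Y, of p] by linarith
    then show ?thesis
      using X Y Z by (simp add: B_def gval_diff_left D_closed torsion_closed T_eq)
  qed
qed

text \<open>\<open>\<N> X Y Z V\<close> is the covariant derivative of the torsion 3-form, \<open>(D\<^sub>X T)(Y, Z, V)\<close>, and \<open>\<Q>\<close> is the
  quadratic torsion term. Curvatures and \<open>dT\<close> are compared through these two.\<close>

definition \<N> :: "'m vfield \<Rightarrow> 'm vfield \<Rightarrow> 'm vfield \<Rightarrow> 'm vfield \<Rightarrow> 'm \<Rightarrow> real"
  where "\<N> X Y Z V p =
    vderiv X (T Y Z V) p - T (D X Y) Z V p - T Y (D X Z) V p - T Y Z (D X V) p"

definition \<Q> :: "'m vfield \<Rightarrow> 'm vfield \<Rightarrow> 'm vfield \<Rightarrow> 'm vfield \<Rightarrow> 'm \<Rightarrow> real"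
  where "\<Q> X Y Z V p = gval g (\<tau> X Y) (\<tau> Z V) p"

lemma N_eq:
  assumes "X \<in> VF" "Y \<in> VF" "Z \<in> VF" "V \<in> VF"
  shows "\<N> X Y Z V p = gval g (D X (\<tau> Y Z)) V p - T (D X Y) Z V p - T Y (D X Z) V p"
  using compat[of X "\<tau> Y Z" V p] assms by (simp add: \<N>_def T_eq torsion_closed)

lemma vderiv_minus:
  assumes "X \<in> VF" "smooth_fun A f"
  shows "vderiv X (- f) p = - vderiv X f p"
  using vderiv_diff[OF manifold assms(1) smooth_fun_const[OF manifold, of 0] assms(2)]
    vderiv_const[OF manifold assms(1)] by (simp add: fun_diff_def fun_Compl_def)

lemma N_skew_23:
  assumes "X \<in> VF" "Y \<in> VF" "Z \<in> VF" "V \<in> VF"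
  shows "\<N> X Z Y V p = - \<N> X Y Z V p"
proof -
  note closed = D_closed[OF assms(1)] assms
  have "T Z Y V = - T Y Z V" "T (D X Z) Y V = - T Y (D X Z) V" "T Z (D X Y) V = - T (D X Y) Z V"
    "T Z Y (D X V) = - T Y Z (D X V)"
    by (intro T_skew_12 closed)+
  then show ?thesis
    using vderiv_minus[OF assms(1) smooth_T[OF assms(2-4)]] by (simp add: \<N>_def)
qed

lemma N_skew_34:
  assumes "X \<in> VF" "Y \<in> VF" "Z \<in> VF" "V \<in> VF"
  shows "\<N> X Y V Z p = - \<N> X Y Z V p"
proof -
  note closed = D_closed[OF assms(1)] assms
  have "T Y V Z = - T Y Z V" "T (D X Y) V Z = - T (D X Y) Z V" "T Y (D X V) Z = - T Y Z (D X V)"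
    "T Y V (D X Z) = - T Y (D X Z) V"
    by (intro T_skew_23 closed)+
  then show ?thesis
    using vderiv_minus[OF assms(1) smooth_T[OF assms(2-4)]] by (simp add: \<N>_def)
qed

lemma N_perms:
  assumes "X \<in> VF" "Y \<in> VF" "Z \<in> VF" "V \<in> VF"
  shows "\<N> X Z Y V p = - \<N> X Y Z V p" "\<N> X Y V Z p = - \<N> X Y Z V p" "\<N> X Z V Y p = \<N> X Y Z V p"
    "\<N> X V Y Z p = \<N> X Y Z V p" "\<N> X V Z Y p = - \<N> X Y Z V p"
  using N_skew_23[OF assms, of p] N_skew_34[OF assms, of p] N_skew_34[OF assms(1,3,2,4), of p]
    N_skew_23[OF assms(1,2,4,3), of p] N_skew_23[OF assms(1,3,4,2), of p] by linarith+

lemma Q_skew_12: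
  assumes "X \<in> VF" "Y \<in> VF" "Z \<in> VF" "V \<in> VF"
  shows "\<Q> Y X Z V p = - \<Q> X Y Z V p"
  using assms by (simp add: \<Q>_def torsion_skew[of Y X] gval_minus_left torsion_closed)

lemma Q_sym:
  assumes "X \<in> VF" "Y \<in> VF" "Z \<in> VF" "V \<in> VF"
  shows "\<Q> Z V X Y p = \<Q> X Y Z V p"
  using assms by (simp add: \<Q>_def gval_sym[of "\<tau> X Y"] torsion_closed)

lemma Q_perms:
  assumes "X \<in> VF" "Y \<in> VF" "Z \<in> VF" "V \<in> VF"
  shows "\<Q> Y X Z V p = - \<Q> X Y Z V p" "\<Q> X Y V Z p = - \<Q> X Y Z V p" "\<Q> Y X V Z p = \<Q> X Y Z V p"
    "\<Q> Z V X Y p = \<Q> X Y Z V p" "\<Q> V Z X Y p = - \<Q> X Y Z V p"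
    "\<Q> Z V Y X p = - \<Q> X Y Z V p" "\<Q> V Z Y X p = \<Q> X Y Z V p"
  using Q_skew_12[OF assms, of p] Q_skew_12[OF assms(1,2,4,3), of p] Q_skew_12[OF assms(3,4,1,2), of p]
    Q_skew_12[OF assms(3,4,2,1), of p] Q_sym[OF assms, of p] Q_sym[OF assms(1,2,4,3), of p]
    Q_sym[OF assms(2,1,3,4), of p] Q_sym[OF assms(2,1,4,3), of p] by linarith+

lemma Q_T:
  shows "T X Y (\<tau> Z V) p = \<Q> X Y Z V p"
  by (simp add: \<Q>_def torsion_form_def)

lemma Q_T_mid:
  assumes "X \<in> VF" "Y \<in> VF" "Z \<in> VF" "V \<in> VF"
  shows "T X (\<tau> Z V) Y p = - \<Q> X Y Z V p"
  using assms by (simp add: T_skew_23[of X "\<tau> Z V"] torsion_closed Q_T)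

lemma hull_curvature:
  assumes "X \<in> VF" "Y \<in> VF" "Z \<in> VF" "V \<in> VF"
  shows "curvature4 g Dh X Y Z V p = curvature4 g D X Y Z V p - \<N> X Y Z V p + \<N> Y X Z V p
    - \<Q> X Y Z V p - \<Q> X V Y Z p + \<Q> Y V X Z p"
proof -
  have second: "gval g (Dh P (Dh Q Z)) V p = gval g (D P (D Q Z)) V p - gval g (D P (\<tau> Q Z)) V p
      - T P (D Q Z) V p - \<Q> P V Q Z p" if "P \<in> VF" "Q \<in> VF" for P Q
  proof -
    have "T P (D Q Z - \<tau> Q Z) V p = T P (D Q Z) V p - T P (\<tau> Q Z) V p"
      using that assms
      by (simp add: T_skew_23[of P _ V] torsion_closed D_closed vf_diff)
        (simp add: T_eq[symmetric] gval_diff_right torsion_closed D_closed)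
    then show ?thesis
      using that assms
      by (simp add: Dh_eq D_closed torsion_closed vf_diff D_diff_right gval_diff_left Q_T_mid T_eq)
  qed
  have "gval g (Dh (lie_bracket X Y) Z) V p = gval g (D (lie_bracket X Y) Z) V p
      - T (D X Y) Z V p + T (D Y X) Z V p + \<Q> X Y Z V p"
    using assms T_bracket_1[of Z V X Y p] Q_sym[of X Y Z V p]
    by (simp add: Dh_eq bracket_closed gval_diff_left D_closed torsion_closed T_eq Q_T)
  then show ?thesis
    using assms by (simp add: H.curvature4_expand curvature4_expand second N_eq)
qed

lemma first_bianchi:
  assumes "X \<in> VF" "Y \<in> VF" "Z \<in> VF" "V \<in> VF"
  shows "curvature4 g D X Y Z V p + curvature4 g D Y Z X V p + curvature4 g D Z X Y V p =
    \<N> X Y Z V p + \<N> Y Z X V p + \<N> Z X Y V p + \<Q> X Y Z V p + \<Q> Y Z X V p + \<Q> Z X Y V p"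
proof -
  have N: "\<N> P Q R V p = gval g (D P (D Q R)) V p - gval g (D P (D R Q)) V p
      - gval g (D (lie_bracket Q R) P) V p - gval g (lie_bracket P (lie_bracket Q R)) V p
      - T P (D Q R) V p + T P (D R Q) V p - \<Q> P V Q R p - T (D P Q) R V p - T Q (D P R) V p"
    if "P \<in> VF" "Q \<in> VF" "R \<in> VF" for P Q R
  proof -
    have "gval g (D P (\<tau> Q R)) V p = gval g (D P (D Q R)) V p - gval g (D P (D R Q)) V p
        - gval g (D P (lie_bracket Q R)) V p"
      using that assms by (simp add: torsion_def D_diff_right gval_diff_left D_closed bracket_closed vf_diff)
    moreover have "gval g (D P (lie_bracket Q R)) V p = gval g (D (lie_bracket Q R) P) V p
        + T P (lie_bracket Q R) V p + gval g (lie_bracket P (lie_bracket Q R)) V p"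
      using that assms by (simp add: T_eq[symmetric] torsion_def gval_diff_left D_closed bracket_closed vf_diff)
    moreover have "T P (lie_bracket Q R) V p = T P (D Q R) V p - T P (D R Q) V p + \<Q> P V Q R p"
      using that assms T_bracket_3[of P V Q R p]
      by (simp add: T_skew_23[of P _ V] D_closed bracket_closed Q_T)
    ultimately show ?thesis using that assms by (simp add: N_eq)
  qed
  have "gval g (lie_bracket X (lie_bracket Y Z) + lie_bracket Y (lie_bracket Z X)
      + lie_bracket Z (lie_bracket X Y)) V p = 0"
    using jacobi_identity[OF manifold assms(1-3)] gval_scale_left[OF assms(4,4), of 0 p] assms
    by (simp add: bracket_closed)
  then have jacobi: "gval g (lie_bracket X (lie_bracket Y Z)) V p + gval g (lie_bracket Y (lie_bracket Z X)) V p
      + gval g (lie_bracket Z (lie_bracket X Y)) V p = 0"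
    using assms by (simp add: gval_add_left bracket_closed vf_add)
  have T: "T (D P Q) R V p = - T R (D P Q) V p" if "P \<in> VF" "Q \<in> VF" "R \<in> VF" for P Q R
    using T_skew_12[of "D P Q" R V] that assms by (simp add: D_closed)
  show ?thesis
    using jacobi N[OF assms(1-3)] N[OF assms(2,3,1)] N[OF assms(3,1,2)]
      curvature4_expand[OF assms, of p] curvature4_expand[OF assms(2,3,1,4), of p]
      curvature4_expand[OF assms(3,1,2,4), of p]
      T[OF assms(1-3)] T[OF assms(2,3,1)] T[OF assms(3,1,2)]
      Q_perms(4)[OF assms(1,4,2,3), of p] Q_perms(4)[OF assms(2,4,3,1), of p]
      Q_perms(4)[OF assms(3,4,1,2), of p]
    by linarith
qed

lemma ext_deriv_torsion:
  assumes "X \<in> VF" "Y \<in> VF" "Z \<in> VF" "V \<in> VF"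
  shows "ext_deriv3 T X Y Z V p = \<N> X Y Z V p - \<N> Y X Z V p + \<N> Z X Y V p - \<N> V X Y Z p
    + 2 * (\<Q> X Y Z V p + \<Q> Y Z X V p + \<Q> Z X Y V p)"
proof -
  have T12: "T P (D Q R) S p = - T (D Q R) P S p" and T13: "T P S (D Q R) p = T (D Q R) P S p"
    if "P \<in> VF" "Q \<in> VF" "R \<in> VF" "S \<in> VF" for P Q R S
    using T_skew_12[of P "D Q R" S] T_cyclic[of "D Q R" P S] that by (simp_all add: D_closed)
  show ?thesis
    unfolding ext_deriv3_def \<N>_def
    using T_bracket_1[OF assms(3,4,1,2), of p] T_bracket_1[OF assms(2,4,1,3), of p]
      T_bracket_1[OF assms(2,3,1,4), of p] T_bracket_1[OF assms(1,4,2,3), of p]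
      T_bracket_1[OF assms(1,3,2,4), of p] T_bracket_1[OF assms(1,2,3,4), of p]
      T12[OF assms(2,1,3,4)] T13[OF assms(2,1,4,3)] T12[OF assms(1,2,3,4)] T13[OF assms(1,2,4,3)]
      T12[OF assms(1,3,2,4)] T13[OF assms(1,3,4,2)] T12[OF assms(1,4,2,3)] T13[OF assms(1,4,3,2)]
      Q_perms[OF assms, of p] Q_perms[OF assms(2,3,1,4), of p] Q_perms[OF assms(3,1,2,4), of p]
    by (simp add: Q_T)
qed

text \<open>Exchanging the two argument pairs of the curvature replaces the connection by the one with
  opposite torsion, up to \<open>dT\<close>. As for the pair symmetry of the Riemann tensor, the Bianchi
  identities for the four cyclic shifts of the arguments are combined.\<close>

lemma pair_exchange:
  assumes "X \<in> VF" "Y \<in> VF" "Z \<in> VF" "V \<in> VF"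
  shows "ext_deriv3 T X Y Z V p = 2 * (curvature4 g D X Y Z V p - curvature4 g Dh Z V X Y p)"
proof -
  note mem = assms
  have skews: "curvature4 g D P Q S R p = - curvature4 g D P Q R S p"
    "curvature4 g D Q P R S p = - curvature4 g D P Q R S p"
    "curvature4 g D Q P S R p = curvature4 g D P Q R S p"
    if "P \<in> VF" "Q \<in> VF" "R \<in> VF" "S \<in> VF" for P Q R S
    using curvature4_skew_12[OF that, of p] curvature4_skew_12[OF that(1,2,4,3), of p]
      curvature4_skew_34[OF that, of p] by linarith+
  note N = N_perms[OF mem, of p] N_perms[OF mem(2,1,3,4), of p] N_perms[OF mem(3,1,2,4), of p]
    N_perms[OF mem(4,1-3), of p]
  note Q = Q_perms[OF mem, of p] Q_perms[OF mem(1,3,2,4), of p] Q_perms[OF mem(1,4,2,3), of p]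
  note R = skews[OF mem] skews[OF mem(1,3,2,4)] skews[OF mem(1,4,2,3)]
    skews[OF mem(3,4,1,2)] skews[OF mem(2,4,1,3)] skews[OF mem(2,3,1,4)]
  show ?thesis
    unfolding ext_deriv_torsion[OF mem] hull_curvature[OF mem(3,4,1,2)]
    using first_bianchi[OF mem, of p] first_bianchi[OF mem(2-4,1), of p]
      first_bianchi[OF mem(3,4,1,2), of p] first_bianchi[OF mem(4,1-3), of p]
    unfolding N Q R by algebra
qed

end

section \<open>Orthonormal bases\<close>

lemma linear_on_sum:
  fixes f :: "'a::real_vector \<Rightarrow> 'b::real_vector"
  assumes S: "subspace S"
    and add: "\<And>u v. u \<in> S \<Longrightarrow> v \<in> S \<Longrightarrow> f (u + v) = f u + f v"
    and scale: "\<And>c u. u \<in> S \<Longrightarrow> f (c *\<^sub>R u) = c *\<^sub>R f u"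
    and "\<And>i. i \<in> I \<Longrightarrow> x i \<in> S"
  shows "f (\<Sum>i\<in>I. c i *\<^sub>R x i) = (\<Sum>i\<in>I. c i *\<^sub>R f (x i))"
proof -
  have zero: "f 0 = 0" using scale[OF subspace_0[OF S], of 0] by simp
  show ?thesis
  proof (cases "finite I")
    case True
    from this assms(4) show ?thesis
      by (induction I) (simp_all add: zero add scale subspace_scale[OF S] subspace_sum[OF S])
  qed (simp add: zero)
qed

context metric_connection
begin

abbreviation "TM \<equiv> tangent_space A"

lemmas TM_subspace = subspace_tangent_space[OF manifold]

lemma g_right:
  assumes "u \<in> TM p" "v \<in> TM p" "w \<in> TM p"
  shows g_add_right: "g p w (u + v) = g p w u + g p w v"
    and g_scale_right: "g p w (c *\<^sub>R u) = c *\<^sub>R g p w u"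
  using assms by (simp_all add: g_sym[of w] g_add_left g_scale_left
      subspace_add[OF TM_subspace] subspace_scale[OF TM_subspace])

end

locale metric_connection_6 = metric_connection A g D
  for A :: "('m::{t2_space,second_countable_topology}, 6) chart set" and g D
begin

lemma orthonormal_basisD:
  assumes "orthonormal_basis A g p E"
  shows "i \<in> {1..6} \<Longrightarrow> E i \<in> TM p" "span (E ` {1..6}) = TM p"
    and "i \<in> {1..6} \<Longrightarrow> j \<in> {1..6} \<Longrightarrow> g p (E i) (E j) = (if i = j then 1 else 0)"
  using assms unfolding orthonormal_basis_def by blast+

lemma orthonormal_expansion:
  assumes E: "orthonormal_basis A g p E" and u: "u \<in> TM p"
  shows "u = (\<Sum>i\<in>{1..6}. g p u (E i) *\<^sub>R E i)"
proof -
  note E = orthonormal_basisD[OF E]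
  note sub = TM_subspace[of p]
  have "u \<in> span (E ` {1..6})" using E(2) u by simp
  then have "u \<in> TM p \<and> u = (\<Sum>i\<in>{1..6}. g p u (E i) *\<^sub>R E i)"
  proof (induction rule: span_induct)
    case base
    show ?case
      unfolding subspace_def
    proof (intro conjI ballI allI)
      show "0 \<in> {u. u \<in> TM p \<and> u = (\<Sum>i\<in>{1..6}. g p u (E i) *\<^sub>R E i)}"
        using subspace_0[OF sub] g_scale_left[OF subspace_0[OF sub] E(1), of _ 0] by simp
      show "u + v \<in> {u. u \<in> TM p \<and> u = (\<Sum>i\<in>{1..6}. g p u (E i) *\<^sub>R E i)}"
        if "u \<in> {u. u \<in> TM p \<and> u = (\<Sum>i\<in>{1..6}. g p u (E i) *\<^sub>R E i)}"
          "v \<in> {u. u \<in> TM p \<and> u = (\<Sum>i\<in>{1..6}. g p u (E i) *\<^sub>R E i)}" for u v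
      proof -
        have "(\<Sum>i\<in>{1..6}. g p (u + v) (E i) *\<^sub>R E i) =
            (\<Sum>i\<in>{1..6}. g p u (E i) *\<^sub>R E i) + (\<Sum>i\<in>{1..6}. g p v (E i) *\<^sub>R E i)"
          unfolding sum.distrib[symmetric] using that E(1)
          by (intro sum.cong refl) (simp add: g_add_left scaleR_add_left)
        then show ?thesis using that subspace_add[OF sub] by auto
      qed
      show "c *\<^sub>R u \<in> {u. u \<in> TM p \<and> u = (\<Sum>i\<in>{1..6}. g p u (E i) *\<^sub>R E i)}"
        if "u \<in> {u. u \<in> TM p \<and> u = (\<Sum>i\<in>{1..6}. g p u (E i) *\<^sub>R E i)}" for c u
      proof -
        have "(\<Sum>i\<in>{1..6}. g p (c *\<^sub>R u) (E i) *\<^sub>R E i) = c *\<^sub>R (\<Sum>i\<in>{1..6}. g p u (E i) *\<^sub>R E i)"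
          unfolding scaleR_sum_right using that E(1)
          by (intro sum.cong refl) (simp add: g_scale_left)
        then show ?thesis using that subspace_scale[OF sub] by auto
      qed
    qed
  next
    case (step v)
    then obtain j where j: "j \<in> {1..6}" "v = E j" by blast
    have "(\<Sum>i\<in>{1..6}. g p v (E i) *\<^sub>R E i) = (\<Sum>i\<in>{1..6}. if i = j then E i else 0)"
      using j E(3) by (intro sum.cong refl) auto
    also have "\<dots> = v" using j by (simp add: sum.delta)
    finally show ?case using j E(1) by simp
  qed
  then show ?thesis by blast
qed

lemma trace_basis_independent:
  fixes b :: "'m tvec \<Rightarrow> 'm tvec \<Rightarrow> real"
  assumes E: "orthonormal_basis A g p E" and e: "orthonormal_basis A g p e"
    and add: "\<And>u v w. u \<in> TM p \<Longrightarrow> v \<in> TM p \<Longrightarrow> w \<in> TM p \<Longrightarrow>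
      b (u + v) w = b u w + b v w \<and> b w (u + v) = b w u + b w v"
    and scale: "\<And>u w c. u \<in> TM p \<Longrightarrow> w \<in> TM p \<Longrightarrow> b (c *\<^sub>R u) w = c *\<^sub>R b u w \<and> b w (c *\<^sub>R u) = c *\<^sub>R b w u"
  shows "(\<Sum>i\<in>{1..6}. b (E i) (E i)) = (\<Sum>k\<in>{1..6}. b (e k) (e k))"
proof -
  note ED = orthonormal_basisD[OF E] and eD = orthonormal_basisD[OF e]
  note linear_sum = linear_on_sum[OF TM_subspace[of p]]
  have left: "b (\<Sum>k\<in>{1..6}. c k *\<^sub>R e k) w = (\<Sum>k\<in>{1..6}. c k *\<^sub>R b (e k) w)" if "w \<in> TM p" for c w
    by (rule linear_sum[of "\<lambda>u. b u w"]) (use that add scale eD(1) in auto)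
  have right: "b w (\<Sum>k\<in>{1..6}. c k *\<^sub>R e k) = (\<Sum>k\<in>{1..6}. c k *\<^sub>R b w (e k))" if "w \<in> TM p" for c w
    by (rule linear_sum[of "\<lambda>u. b w u"]) (use that add scale eD(1) in auto)
  let ?c = "\<lambda>i k. g p (E i) (e k)"
  have Ei: "b (E i) (E i) = (\<Sum>k\<in>{1..6}. \<Sum>l\<in>{1..6}. ?c i k * ?c i l * b (e k) (e l))"
    if i: "i \<in> {1..6}" for i
  proof -
    note exp = orthonormal_expansion[OF e ED(1)[OF i]]
    have "b (E i) (E i) = b (\<Sum>k\<in>{1..6}. ?c i k *\<^sub>R e k) (E i)"
      using exp by simp
    also have "\<dots> = (\<Sum>k\<in>{1..6}. ?c i k *\<^sub>R b (e k) (E i))"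
      by (rule left[OF ED(1)[OF i]])
    also have "\<dots> = (\<Sum>k\<in>{1..6}. ?c i k *\<^sub>R b (e k) (\<Sum>l\<in>{1..6}. ?c i l *\<^sub>R e l))"
      using exp by simp
    also have "\<dots> = (\<Sum>k\<in>{1..6}. ?c i k *\<^sub>R (\<Sum>l\<in>{1..6}. ?c i l *\<^sub>R b (e k) (e l)))"
      by (intro sum.cong refl arg_cong[where f = "\<lambda>x. _ *\<^sub>R x"] right eD(1))
    finally show ?thesis by (simp add: sum_distrib_left mult.assoc)
  qed
  have orth: "(\<Sum>i\<in>{1..6}. ?c i k * ?c i l) = (if k = l then 1 else 0)"
    if k: "k \<in> {1..6}" and l: "l \<in> {1..6}" for k l
  proof -
    have "g p (e l) (e k) = g p (e l) (\<Sum>i\<in>{1..6}. g p (e k) (E i) *\<^sub>R E i)"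
      using orthonormal_expansion[OF E eD(1)[OF k]] by simp
    also have "\<dots> = (\<Sum>i\<in>{1..6}. g p (e k) (E i) *\<^sub>R g p (e l) (E i))"
      by (rule linear_sum[of "\<lambda>u. g p (e l) u"]) (use g_right eD(1)[OF l] ED(1) in auto)
    also have "\<dots> = (\<Sum>i\<in>{1..6}. ?c i k * ?c i l)"
      using k l by (intro sum.cong refl) (simp add: g_sym[of "e _"] eD(1) ED(1))
    finally show ?thesis using eD(3)[OF l k] by (simp split: if_splits)
  qed
  have "(\<Sum>i\<in>{1..6}. b (E i) (E i)) =
      (\<Sum>i\<in>{1..6}. \<Sum>k\<in>{1..6}. \<Sum>l\<in>{1..6}. ?c i k * ?c i l * b (e k) (e l))"
    by (intro sum.cong refl Ei)
  also have "\<dots> = (\<Sum>k\<in>{1..6}. \<Sum>l\<in>{1..6}. \<Sum>i\<in>{1..6}. ?c i k * ?c i l * b (e k) (e l))"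
    by (subst sum.swap, rule sum.cong[OF refl], rule sum.swap)
  also have "\<dots> = (\<Sum>k\<in>{1..6}. \<Sum>l\<in>{1..6}. (if k = l then b (e k) (e l) else 0))"
    by (intro sum.cong refl) (simp only: sum_distrib_right[symmetric] orth, simp)
  also have "\<dots> = (\<Sum>k\<in>{1..6}. b (e k) (e k))"
    by (intro sum.cong refl) (simp add: sum.delta')
  finally show ?thesis .
qed

text \<open>A linear functional on vector fields that factors through the values at \<open>p\<close> is determined on
  fields forming a basis at \<open>p\<close>.\<close>

lemma vfield_functional_zero:
  fixes L :: "'m vfield \<Rightarrow> real"
  assumes F: "orthonormal_basis A g p (\<lambda>i. F i p)" "\<And>i. i \<in> {1..6} \<Longrightarrow> F i \<in> VF"
    and add: "\<And>U V. U \<in> VF \<Longrightarrow> V \<in> VF \<Longrightarrow> L (U + V) = L U + L V"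
    and scale: "\<And>c U. U \<in> VF \<Longrightarrow> L (c *\<^sub>R U) = c *\<^sub>R L U"
    and local: "\<And>P. P \<in> VF \<Longrightarrow> P p = 0 \<Longrightarrow> L P = 0"
    and basis: "\<And>i. i \<in> {1..6} \<Longrightarrow> L (F i) = 0"
    and U: "U \<in> VF"
  shows "L U = 0"
proof -
  note sub = subspace_vfields[OF manifold]
  define S where "S = (\<Sum>i\<in>{1..6}. g p (U p) (F i p) *\<^sub>R F i)"
  have S: "S \<in> VF"
    unfolding S_def using F(2) by (intro subspace_sum[OF sub] subspace_scale[OF sub])
  have "S p = (\<Sum>i\<in>{1..6}. g p (U p) (F i p) *\<^sub>R F i p)"
    using linear_on_sum[OF subspace_UNIV, of "\<lambda>X. X p" "{1..6}" F]
    by (simp add: S_def scaleR_fun_def)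
  then have "(U - S) p = 0"
    using orthonormal_expansion[OF F(1) vf_tangent[OF U]] by simp
  then have "L (U - S) = 0" using U S by (intro local vf_diff)
  moreover have "L S = (\<Sum>i\<in>{1..6}. g p (U p) (F i p) *\<^sub>R L (F i))"
    unfolding S_def by (rule linear_on_sum[OF sub add scale F(2)])
  then have "L S = 0" using basis by simp
  ultimately show ?thesis
    using add[OF vf_diff[OF U S] S] by simp
qed

end


section \<open>The curvature of the torsion connection\<close>

text \<open>A metric connection preserving an SU(3)-structure.\<close>

locale su3_connection = metric_connection_6 A g D
  for A :: "('m::{t2_space,second_countable_topology}, 6) chart set" and g D +
  fixes J :: "'m endo" and \<Psi> :: "'m cform3"
  assumes su3: "su3_structure A g J \<Psi>"
    and parallel_J: "parallel_endo A D J"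
    and parallel_Re: "parallel_3form A D (Re_form \<Psi>)"
    and parallel_Im: "parallel_3form A D (Im_form \<Psi>)"
begin

lemma almost_complex: "almost_complex A J"
  using su3 by (simp add: su3_structure_def almost_hermitian_def)

lemma J_pointwise:
  assumes "u \<in> TM p" "v \<in> TM p"
  shows J_tangent: "J p u \<in> TM p" and J_add: "J p (u + v) = J p u + J p v"
    and J_scale: "J p (c *\<^sub>R u) = c *\<^sub>R J p u" and J_J: "J p (J p u) = - u"
    and g_J: "g p (J p u) (J p v) = g p u v"
  using almost_complex su3 assms
  unfolding almost_complex_def su3_structure_def almost_hermitian_def by blast+

lemma J_minus: "u \<in> TM p \<Longrightarrow> J p (- u) = - J p u"
  using J_scale[of u p u "-1"] by simp

lemma Jval_closed: "X \<in> VF \<Longrightarrow> Jval J X \<in> VF"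
  using almost_complex by (simp add: almost_complex_def)

lemma Jval_linear:
  assumes "X \<in> VF" "Y \<in> VF"
  shows Jval_add: "Jval J (X + Y) = Jval J X + Jval J Y"
    and Jval_scale: "Jval J (c *\<^sub>R X) = c *\<^sub>R Jval J X"
    and Jval_minus: "Jval J (- X) = - Jval J X"
    and Jval_diff: "Jval J (X - Y) = Jval J X - Jval J Y"
    and Jval_Jval: "Jval J (Jval J X) = - X"
proof -
  show "Jval J (X + Y) = Jval J X + Jval J Y" and "Jval J (- X) = - Jval J X"
    and "Jval J (Jval J X) = - X"
    using J_add[OF vf_tangent[OF assms(1)] vf_tangent[OF assms(2)]] J_minus[OF vf_tangent[OF assms(1)]]
      J_J[OF vf_tangent[OF assms(1)] vf_tangent[OF assms(1)]]
    unfolding Jval_def by (auto simp only: plus_fun_def fun_Compl_def)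
  show "Jval J (c *\<^sub>R X) = c *\<^sub>R Jval J X"
    using J_scale[OF vf_tangent[OF assms(1)] vf_tangent[OF assms(1)]]
    by (simp add: Jval_def scaleR_fun_def fun_eq_iff)
  have "J p (X p + - Y p) = J p (X p) + - J p (Y p)" for p
    by (simp only: J_minus[OF vf_tangent[OF assms(2)]]
        J_add[OF vf_tangent[OF assms(1)] subspace_neg[OF TM_subspace vf_tangent[OF assms(2)]]])
  then show "Jval J (X - Y) = Jval J X - Jval J Y"
    by (simp add: Jval_def fun_eq_iff)
qed

lemma curvature_Jval:
  assumes "X \<in> VF" "Y \<in> VF" "Z \<in> VF"
  shows "curvature D X Y (Jval J Z) = Jval J (curvature D X Y Z)"
proof -
  have DJ: "D P (Jval J Q) = Jval J (D P Q)" if "P \<in> VF" "Q \<in> VF" for P Q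
    using parallel_J that by (simp add: parallel_endo_def)
  show ?thesis
    using assms by (simp add: curvature_def DJ Jval_diff D_closed bracket_closed vf_diff)
qed

lemma curvature4_J_invariant:
  assumes "X \<in> VF" "Y \<in> VF" "Z \<in> VF" "V \<in> VF"
  shows "curvature4 g D X Y (Jval J Z) (Jval J V) p = curvature4 g D X Y Z V p"
  using assms by (simp add: curvature4_def curvature_Jval)
    (simp add: gval_def Jval_def g_J vf_tangent curvature_closed)

text \<open>An orthonormal basis at \<open>p\<close> in which the SU(3)-structure has its normal form. The values of
  \<open>\<Psi>\<close> are computed with the dual basis, whose \<open>i\<close>-th member is \<open>of_bool (l = i)\<close> on \<open>e l\<close>.\<close>

definition adapted_basis :: "'m \<Rightarrow> (nat \<Rightarrow> 'm tvec) \<Rightarrow> bool"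
  where "adapted_basis p e \<longleftrightarrow> orthonormal_basis A g p e \<and>
    J p (e 1) = e 2 \<and> J p (e 2) = - e 1 \<and> J p (e 3) = e 4 \<and> J p (e 4) = - e 3 \<and>
    J p (e 5) = e 6 \<and> J p (e 6) = - e 5 \<and>
    (\<forall>i\<in>{1..6}. \<forall>j\<in>{1..6}. \<forall>k\<in>{1..6}. \<Psi> p (e i) (e j) (e k) =
      - wedge3 (\<lambda>l. of_bool (l = 1) + \<i> * of_bool (l = 2)) (\<lambda>l. of_bool (l = 3) + \<i> * of_bool (l = 4))
        (\<lambda>l. of_bool (l = 5) + \<i> * of_bool (l = 6)) i j k)"

lemma adapted_basis_exists: "\<exists>e. adapted_basis p e"
proof -
  note su3[unfolded su3_structure_def, THEN conjunct2, THEN conjunct2, THEN conjunct2, THEN spec[of _ p]]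
  then obtain W f where "p \<in> W" and f: "orthonormal_coframe_on A g W f"
    and norm_form: "\<forall>q\<in>W. \<forall>u\<in>TM q. \<forall>v\<in>TM q. \<forall>w\<in>TM q.
         kahler_form g J q u v =
           - wedge2 (f 1 q) (f 2 q) u v - wedge2 (f 3 q) (f 4 q) u v
           - wedge2 (f 5 q) (f 6 q) u v \<and>
         \<Psi> q u v w =
           - wedge3 (\<lambda>z. of_real (f 1 q z) + \<i> * of_real (f 2 q z))
                    (\<lambda>z. of_real (f 3 q z) + \<i> * of_real (f 4 q z))
                    (\<lambda>z. of_real (f 5 q z) + \<i> * of_real (f 6 q z)) u v w"
    by (elim exE conjE)
  note norm = bspec[OF bspec[OF bspec[OF bspec[OF norm_form \<open>p \<in> W\<close>]]]]
  have "\<exists>E. orthonormal_basis A g p E \<and>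
      (\<forall>i\<in>{1..6}. \<forall>j\<in>{1..6}. f i p (E j) = (if i = j then 1 else 0))"
    using f[unfolded orthonormal_coframe_on_def, THEN conjunct2, THEN conjunct2] \<open>p \<in> W\<close> by (rule bspec)
  then obtain e where e: "orthonormal_basis A g p e"
    and dual: "\<And>i j. i \<in> {1..6} \<Longrightarrow> j \<in> {1..6} \<Longrightarrow> f i p (e j) = (if i = j then 1 else 0)"
    by blast
  note eD = orthonormal_basisD[OF e]
  have F: "g p (J p (e j)) (e i) = - wedge2 (f 1 p) (f 2 p) (e i) (e j)
      - wedge2 (f 3 p) (f 4 p) (e i) (e j) - wedge2 (f 5 p) (f 6 p) (e i) (e j)"
    if "i \<in> {1..6}" "j \<in> {1..6}" for i j
  proof -
    have "g p (J p (e j)) (e i) = g p (e i) (J p (e j))"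
      using eD(1) that J_tangent by (intro g_sym) auto
    then show ?thesis
      using norm[OF eD(1)[OF that(1)] eD(1)[OF that(2)] eD(1)[OF that(1)]]
      by (simp add: kahler_form_def)
  qed
  have six: "{1..6} = {1, 2, 3, 4, 5, 6::nat}" by auto
  have Je: "J p (e j) = (\<Sum>i\<in>{1..6}. (- wedge2 (f 1 p) (f 2 p) (e i) (e j)
      - wedge2 (f 3 p) (f 4 p) (e i) (e j) - wedge2 (f 5 p) (f 6 p) (e i) (e j)) *\<^sub>R e i)"
    if "j \<in> {1..6}" for j
  proof -
    have "J p (e j) = (\<Sum>i\<in>{1..6}. g p (J p (e j)) (e i) *\<^sub>R e i)"
      by (rule orthonormal_expansion[OF e J_tangent[OF eD(1)[OF that] eD(1)[OF that]]])
    also have "\<dots> = (\<Sum>i\<in>{1..6}. (- wedge2 (f 1 p) (f 2 p) (e i) (e j)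
      - wedge2 (f 3 p) (f 4 p) (e i) (e j) - wedge2 (f 5 p) (f 6 p) (e i) (e j)) *\<^sub>R e i)"
      by (intro sum.cong refl) (simp only: F that)
    finally show ?thesis .
  qed
  have "J p (e 1) = e 2" "J p (e 2) = - e 1" "J p (e 3) = e 4" "J p (e 4) = - e 3"
    "J p (e 5) = e 6" "J p (e 6) = - e 5"
    by (simp_all add: Je six wedge2_def dual del: One_nat_def)
  moreover have "\<Psi> p (e i) (e j) (e k) =
      - wedge3 (\<lambda>l. of_bool (l = 1) + \<i> * of_bool (l = 2)) (\<lambda>l. of_bool (l = 3) + \<i> * of_bool (l = 4))
        (\<lambda>l. of_bool (l = 5) + \<i> * of_bool (l = 6)) i j k"
    if "i \<in> {1..6}" "j \<in> {1..6}" "k \<in> {1..6}" for i j k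
  proof -
    have dual': "complex_of_real (f a p (e b)) = of_bool (b = a)" if "a \<in> {1..6}" "b \<in> {1..6}" for a b
      using dual[OF that] by auto
    show ?thesis
      using norm[OF eD(1)[OF that(1)] eD(1)[OF that(2)] eD(1)[OF that(3)]] that
      by (simp only: wedge3_def dual' atLeastAtMost_iff) (simp add: dual')
  qed
  ultimately show ?thesis using e unfolding adapted_basis_def by blast
qed

text \<open>Members of the family outside the index range of bases are arbitrary vector fields, included
  only to avoid side conditions.\<close>

lemma vfields_basis_extension:
  assumes "orthonormal_basis A g p e"
  shows "\<exists>F. (\<forall>i. F i \<in> VF) \<and> (\<forall>i\<in>{1..6}. F i p = e i)"
proof -
  have "\<exists>X. X \<in> VF \<and> X p = (if i \<in> {1..6} then e i else 0)" for i
    using vfield_extension[OF manifold, of "if i \<in> {1..6} then e i else 0" p]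
      orthonormal_basisD(1)[OF assms] subspace_0[OF TM_subspace] by (metis (full_types))
  then obtain F where F: "\<And>i. F i \<in> VF \<and> F i p = (if i \<in> {1..6} then e i else 0)"
    by metis
  then show ?thesis by (intro exI[of _ F]) simp
qed

lemma Psi_pointwise:
  assumes "u \<in> TM p" "u' \<in> TM p" "v \<in> TM p" "w \<in> TM p"
  shows Psi_add: "\<Psi> p (u + u') v w = \<Psi> p u v w + \<Psi> p u' v w"
    and Psi_scale: "\<Psi> p (c *\<^sub>R u) v w = c *\<^sub>R \<Psi> p u v w"
    and Psi_skew_12: "\<Psi> p u v w = - \<Psi> p v u w"
    and Psi_skew_23: "\<Psi> p u v w = - \<Psi> p u w v"
proof -
  have "complex_3form A \<Psi>" using su3 by (simp add: su3_structure_def)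
  then have "\<Psi> p (u + u') v w = \<Psi> p u v w + \<Psi> p u' v w \<and> \<Psi> p (c *\<^sub>R u) v w = c *\<^sub>R \<Psi> p u v w
      \<and> \<Psi> p u v w = - \<Psi> p v u w \<and> \<Psi> p u v w = - \<Psi> p u w v" for c
    using assms unfolding complex_3form_def by blast
  then show "\<Psi> p (u + u') v w = \<Psi> p u v w + \<Psi> p u' v w" "\<Psi> p (c *\<^sub>R u) v w = c *\<^sub>R \<Psi> p u v w"
    "\<Psi> p u v w = - \<Psi> p v u w" "\<Psi> p u v w = - \<Psi> p u w v" by blast+
qed

lemma Psi_sum:
  assumes v: "v \<in> TM p" and w: "w \<in> TM p" and x: "\<And>i. i \<in> I \<Longrightarrow> x i \<in> TM p"
  shows "\<Psi> p (\<Sum>i\<in>I. c i *\<^sub>R x i) v w = (\<Sum>i\<in>I. c i *\<^sub>R \<Psi> p (x i) v w)"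
    and "\<Psi> p v (\<Sum>i\<in>I. c i *\<^sub>R x i) w = (\<Sum>i\<in>I. c i *\<^sub>R \<Psi> p v (x i) w)"
    and "\<Psi> p v w (\<Sum>i\<in>I. c i *\<^sub>R x i) = (\<Sum>i\<in>I. c i *\<^sub>R \<Psi> p v w (x i))"
proof -
  let ?s = "\<Sum>i\<in>I. c i *\<^sub>R x i"
  have s: "?s \<in> TM p"
    using x by (intro subspace_sum[OF TM_subspace] subspace_scale[OF TM_subspace])
  have first: "\<Psi> p ?s v w = (\<Sum>i\<in>I. c i *\<^sub>R \<Psi> p (x i) v w)" if "v \<in> TM p" "w \<in> TM p" for v w
    by (rule linear_on_sum[OF TM_subspace, of p "\<lambda>u. \<Psi> p u v w"]) (use that x Psi_pointwise in blast)+
  show "\<Psi> p ?s v w = (\<Sum>i\<in>I. c i *\<^sub>R \<Psi> p (x i) v w)"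
    by (rule first[OF v w])
  have "\<Psi> p v ?s w = - (\<Sum>i\<in>I. c i *\<^sub>R \<Psi> p (x i) v w)"
    using Psi_skew_12[OF v v s w] first[OF v w] by simp
  also have "\<dots> = (\<Sum>i\<in>I. c i *\<^sub>R \<Psi> p v (x i) w)"
    unfolding sum_negf[symmetric] using Psi_skew_12[OF v v x w] by (intro sum.cong refl) simp
  finally show "\<Psi> p v ?s w = (\<Sum>i\<in>I. c i *\<^sub>R \<Psi> p v (x i) w)" .
  have "\<Psi> p v w ?s = (\<Sum>i\<in>I. c i *\<^sub>R \<Psi> p (x i) v w)"
    using Psi_skew_23[OF v v w s] Psi_skew_12[OF v v s w] first[OF v w] by simp
  also have "\<dots> = (\<Sum>i\<in>I. c i *\<^sub>R \<Psi> p v w (x i))"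
    using Psi_skew_23[OF v v w x] Psi_skew_12[OF v v x w] by (intro sum.cong refl) simp
  finally show "\<Psi> p v w ?s = (\<Sum>i\<in>I. c i *\<^sub>R \<Psi> p v w (x i))" .
qed

lemma Psi_diff:
  assumes "u \<in> TM p" "u' \<in> TM p" "v \<in> TM p" "w \<in> TM p"
  shows "\<Psi> p (u - u') v w = \<Psi> p u v w - \<Psi> p u' v w"
    and "\<Psi> p v (u - u') w = \<Psi> p v u w - \<Psi> p v u' w"
    and "\<Psi> p v w (u - u') = \<Psi> p v w u - \<Psi> p v w u'"
proof -
  have "\<Psi> p (u - u' + u') v w = \<Psi> p (u - u') v w + \<Psi> p u' v w" if "v \<in> TM p" "w \<in> TM p" for v w
    using assms that by (intro Psi_add subspace_diff[OF TM_subspace])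
  then have first: "\<Psi> p (u - u') v w = \<Psi> p u v w - \<Psi> p u' v w" if "v \<in> TM p" "w \<in> TM p" for v w
    using that by simp
  have d: "u - u' \<in> TM p" using assms by (intro subspace_diff[OF TM_subspace])
  note Psi_skew_12[OF assms(3,3) _ assms(4)] Psi_skew_23[OF assms(3,3,4)]
  note sk = this(1)[OF d] this(1)[OF assms(1)] this(1)[OF assms(2)]
    this(2)[OF d] this(2)[OF assms(1)] this(2)[OF assms(2)]
  show "\<Psi> p (u - u') v w = \<Psi> p u v w - \<Psi> p u' v w"
    using first assms by blast
  show "\<Psi> p v (u - u') w = \<Psi> p v u w - \<Psi> p v u' w"
    unfolding sk(1-3) first[OF assms(3,4)] by simp
  show "\<Psi> p v w (u - u') = \<Psi> p v w u - \<Psi> p v w u'"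
    unfolding sk(4-6) unfolding sk(1-3) first[OF assms(3,4)] by simp
qed

lemma curvature_Psi:
  assumes "X \<in> VF" "Y \<in> VF" "U \<in> VF" "V \<in> VF" "W \<in> VF"
  shows "\<Psi> p (curvature D X Y U p) (V p) (W p) + \<Psi> p (U p) (curvature D X Y V p) (W p)
    + \<Psi> p (U p) (V p) (curvature D X Y W p) = 0"
proof -
  have smooth: "smooth_fun A (Re_form \<Psi> X Y Z)" "smooth_fun A (Im_form \<Psi> X Y Z)"
    if "X \<in> VF" "Y \<in> VF" "Z \<in> VF" for X Y Z
    using su3 that by (simp_all add: su3_structure_def complex_3form_def Re_form_def Im_form_def)
  have "Re_form \<Psi> (curvature D X Y U) V W p + Re_form \<Psi> U (curvature D X Y V) W p
      + Re_form \<Psi> U V (curvature D X Y W) p = 0"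
    by (rule curvature_parallel_3form[OF parallel_Re smooth(1) _ assms])
      (simp_all add: Re_form_def fun_eq_iff Psi_diff vf_tangent)
  moreover have "Im_form \<Psi> (curvature D X Y U) V W p + Im_form \<Psi> U (curvature D X Y V) W p
      + Im_form \<Psi> U V (curvature D X Y W) p = 0"
    by (rule curvature_parallel_3form[OF parallel_Im smooth(2) _ assms])
      (simp_all add: Im_form_def fun_eq_iff Psi_diff vf_tangent)
  ultimately show ?thesis
    by (simp add: Re_form_def Im_form_def complex_eq_iff)
qed

text \<open>The curvature endomorphisms of a connection preserving \<open>\<Psi>\<close> have vanishing complex trace.
  In an adapted basis the imaginary part of the derivation property on \<open>e 1, e 3, e 5\<close> says
  just this.\<close>

lemma curvature_trace_zero:
  assumes X: "X \<in> VF" and Y: "Y \<in> VF" and E: "\<And>i. i \<in> {1..6} \<Longrightarrow> E i \<in> VF"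
    and basis: "orthonormal_basis A g p (\<lambda>i. E i p)"
  shows "(\<Sum>i\<in>{1..6}. curvature4 g D X Y (E i) (Jval J (E i)) p) = 0"
proof -
  obtain e where "adapted_basis p e" using adapted_basis_exists by blast
  then have e: "orthonormal_basis A g p e"
    and Je: "J p (e 1) = e 2" "J p (e 2) = - e 1" "J p (e 3) = e 4" "J p (e 4) = - e 3"
      "J p (e 5) = e 6" "J p (e 6) = - e 5"
    and Psi: "\<And>i j k. i \<in> {1..6} \<Longrightarrow> j \<in> {1..6} \<Longrightarrow> k \<in> {1..6} \<Longrightarrow> \<Psi> p (e i) (e j) (e k) =
      - wedge3 (\<lambda>l. of_bool (l = 1) + \<i> * of_bool (l = 2)) (\<lambda>l. of_bool (l = 3) + \<i> * of_bool (l = 4))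
        (\<lambda>l. of_bool (l = 5) + \<i> * of_bool (l = 6)) i j k"
    unfolding adapted_basis_def by blast+
  note eD = orthonormal_basisD[OF e]
  obtain F where F_ext: "\<forall>i. F i \<in> VF" "\<forall>i\<in>{1..6}. F i p = e i"
    using vfields_basis_extension[OF e] by (elim exE conjE)
  note F = F_ext[rule_format]
  have "\<forall>u. \<exists>X. u \<in> TM p \<longrightarrow> X \<in> VF \<and> X p = u"
    using vfield_extension[OF manifold] by blast
  from choice[OF this] obtain ext where "\<forall>u. u \<in> TM p \<longrightarrow> ext u \<in> VF \<and> ext u p = u"
    by (elim exE)
  then have ext: "\<And>u. u \<in> TM p \<Longrightarrow> ext u \<in> VF" "\<And>u. u \<in> TM p \<Longrightarrow> ext u p = u"
    by blast+
  define a where "a = (\<lambda>u v. curvature4 g D X Y (ext u) (ext v) p)"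
  note sub = TM_subspace[of p]
  have a: "curvature4 g D X Y U V p = a (U p) (V p)" if "U \<in> VF" "V \<in> VF" for U V
    unfolding a_def using that X Y by (intro curvature4_cong_34) (simp_all add: ext vf_tangent)
  have skew: "a u v = - a v u" if "u \<in> TM p" "v \<in> TM p" for u v
    unfolding a_def using that X Y ext by (intro curvature4_skew_34)
  have add: "a w (u + v) = a w u + a w v" if "u \<in> TM p" "v \<in> TM p" "w \<in> TM p" for u v w
    using a[of "ext w" "ext u + ext v"] curvature4_linear_4(1)[of X Y "ext w" "ext u" "ext v" p] that X Y
    by (simp add: a ext vf_add)
  have scale: "a w (c *\<^sub>R u) = c *\<^sub>R a w u" if "u \<in> TM p" "w \<in> TM p" for u w c
  proof -
    have "(c *\<^sub>R ext u) p = c *\<^sub>R u"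
      using ext(2)[OF that(1)] by (simp add: scaleR_fun_def)
    then show ?thesis
      using a[of "ext w" "c *\<^sub>R ext u"] curvature4_linear_4(2)[of X Y "ext w" "ext u" "ext u" c p] that X Y
      by (simp add: a ext vf_scale)
  qed
  have "(\<Sum>i\<in>{1..6}. curvature4 g D X Y (E i) (Jval J (E i)) p)
      = (\<Sum>i\<in>{1..6}. a (E i p) (J p (E i p)))"
    using a[OF E Jval_closed[OF E]] by (intro sum.cong refl) (simp add: Jval_def)
  also have "\<dots> = (\<Sum>k\<in>{1..6}. a (e k) (J p (e k)))"
  proof (rule trace_basis_independent[OF basis e, of "\<lambda>u v. a u (J p v)"])
    fix u v w assume T: "u \<in> TM p" "v \<in> TM p" "w \<in> TM p"
    note JT = J_tangent[OF T(1,1)] J_tangent[OF T(2,2)] J_tangent[OF T(3,3)]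
    have "a (u + v) (J p w) = a u (J p w) + a v (J p w)"
      using add[OF T(1,2) JT(3)] skew[OF subspace_add[OF sub T(1,2)] JT(3)] skew[OF T(1) JT(3)]
        skew[OF T(2) JT(3)] by simp
    then show "a (u + v) (J p w) = a u (J p w) + a v (J p w)
        \<and> a w (J p (u + v)) = a w (J p u) + a w (J p v)"
      using add[OF JT(1,2) T(3)] J_add[OF T(1,2)] by simp
  next
    fix u w c assume T: "u \<in> TM p" "w \<in> TM p"
    note JT = J_tangent[OF T(1,1)] J_tangent[OF T(2,2)]
    have "a (c *\<^sub>R u) (J p w) = c *\<^sub>R a u (J p w)"
      using scale[OF T(1) JT(2), of c] skew[OF subspace_scale[OF sub T(1)] JT(2), of c] skew[OF T(1) JT(2)]
      by simp
    then show "a (c *\<^sub>R u) (J p w) = c *\<^sub>R a u (J p w) \<and> a w (J p (c *\<^sub>R u)) = c *\<^sub>R a w (J p u)"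
      using scale[OF JT(1) T(2), of c] J_scale[OF T(1,1), of c] by simp
  qed
  also have "\<dots> = 2 * (a (e 1) (e 2) + a (e 3) (e 4) + a (e 5) (e 6))"
  proof -
    have neg: "a (e i) (- e j) = a (e j) (e i)" if "i \<in> {1..6}" "j \<in> {1..6}" for i j
      using scale[OF eD(1)[OF that(2)] eD(1)[OF that(1)], of "-1"] skew[OF eD(1) eD(1), OF that] by simp
    have "{1..6} = {1, 2, 3, 4, 5, 6::nat}" by auto
    then have "(\<Sum>k\<in>{1..6}. a (e k) (J p (e k))) = a (e 1) (J p (e 1)) + a (e 2) (J p (e 2))
        + a (e 3) (J p (e 3)) + a (e 4) (J p (e 4)) + a (e 5) (J p (e 5)) + a (e 6) (J p (e 6))"
      by (simp del: One_nat_def)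
    then show ?thesis
      using neg[of 2 1] neg[of 4 3] neg[of 6 5] by (simp only: Je) simp
  qed
  also have "a (e 1) (e 2) + a (e 3) (e 4) + a (e 5) (e 6) = 0"
  proof -
    have R: "curvature D X Y (F i) p = (\<Sum>j\<in>{1..6}. a (e i) (e j) *\<^sub>R e j)" if "i \<in> {1..6}" for i
    proof -
      have "g p (curvature D X Y (F i) p) (e j) = a (e i) (e j)" if "j \<in> {1..6}" for j
        using a[OF F(1) F(1), of i j] F(2)[OF that] F(2)[OF \<open>i \<in> {1..6}\<close>]
        by (simp add: curvature4_def gval_def)
      then have "(\<Sum>j\<in>{1..6}. a (e i) (e j) *\<^sub>R e j)
          = (\<Sum>j\<in>{1..6}. g p (curvature D X Y (F i) p) (e j) *\<^sub>R e j)"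
        by simp
      also have "\<dots> = curvature D X Y (F i) p"
        by (rule orthonormal_expansion[OF e, symmetric]) (intro vf_tangent curvature_closed X Y F(1))
      finally show ?thesis by simp
    qed
    have i: "1 \<in> {1..6::nat}" "2 \<in> {1..6::nat}" "3 \<in> {1..6::nat}" "4 \<in> {1..6::nat}"
      "5 \<in> {1..6::nat}" "6 \<in> {1..6::nat}" by simp_all
    have Psi':
      "\<Psi> p (\<Sum>j\<in>{1..6}. c j *\<^sub>R e j) (e k) (e l) = (\<Sum>j\<in>{1..6}. c j *\<^sub>R \<Psi> p (e j) (e k) (e l))"
      "\<Psi> p (e k) (\<Sum>j\<in>{1..6}. c j *\<^sub>R e j) (e l) = (\<Sum>j\<in>{1..6}. c j *\<^sub>R \<Psi> p (e k) (e j) (e l))"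
      "\<Psi> p (e k) (e l) (\<Sum>j\<in>{1..6}. c j *\<^sub>R e j) = (\<Sum>j\<in>{1..6}. c j *\<^sub>R \<Psi> p (e k) (e l) (e j))"
      if "k \<in> {1..6}" "l \<in> {1..6}" for c k l
      by (rule Psi_sum[where x = e, OF eD(1)[OF that(1)] eD(1)[OF that(2)] eD(1)], assumption)+
    have six: "{1..6} = {1, 2, 3, 4, 5, 6::nat}" by auto
    have "\<Psi> p (\<Sum>j\<in>{1..6}. a (e 1) (e j) *\<^sub>R e j) (e 3) (e 5) = - a (e 1) (e 1) - \<i> * a (e 1) (e 2)"
      unfolding Psi'(1)[OF i(3,5)] unfolding six
      by (simp add: Psi wedge3_def scaleR_conv_of_real del: One_nat_def)
    moreover have "\<Psi> p (e 1) (\<Sum>j\<in>{1..6}. a (e 3) (e j) *\<^sub>R e j) (e 5) = - a (e 3) (e 3) - \<i> * a (e 3) (e 4)"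
      unfolding Psi'(2)[OF i(1,5)] unfolding six
      by (simp add: Psi wedge3_def scaleR_conv_of_real del: One_nat_def)
    moreover have "\<Psi> p (e 1) (e 3) (\<Sum>j\<in>{1..6}. a (e 5) (e j) *\<^sub>R e j) = - a (e 5) (e 5) - \<i> * a (e 5) (e 6)"
      unfolding Psi'(3)[OF i(1,3)] unfolding six
      by (simp add: Psi wedge3_def scaleR_conv_of_real del: One_nat_def)
    moreover note curvature_Psi[OF X Y F(1)[of 1] F(1)[of 3] F(1)[of 5], of p,
        unfolded R[OF i(1)] R[OF i(3)] R[OF i(5)] F(2)[OF i(1)] F(2)[OF i(3)] F(2)[OF i(5)]]
    ultimately show ?thesis by (simp add: complex_eq_iff)
  qed
  finally show ?thesis by simp
qed

end

section \<open>Four-forms in dimension six\<close>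

text \<open>A 4-form on a 6-dimensional Hermitian vector space whose contraction with the fundamental
  2-form vanishes is zero; here in coordinates, with complex lines spanned by the basis vectors
  1 and 2, 3 and 4, 5 and 6. Among four of the six indices two belong to the same line, and
  the components \<open>w a b c d\<close> with \<open>c, d\<close> spanning a line vanish by the trace condition.\<close>

lemma primitive_4form_zero:
  fixes w :: "nat \<Rightarrow> nat \<Rightarrow> nat \<Rightarrow> nat \<Rightarrow> real"
  assumes s12: "\<And>a b c d. w a b c d = - w b a c d"
    and s23: "\<And>a b c d. w a b c d = - w a c b d"
    and s34: "\<And>a b c d. w a b c d = - w a b d c"
    and trace: "\<And>a b. a \<in> {1..6} \<Longrightarrow> b \<in> {1..6} \<Longrightarrow> w a b 1 2 + w a b 3 4 + w a b 5 6 = 0"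
    and idx: "i \<in> {1..6}" "j \<in> {1..6}" "k \<in> {1..6}" "l \<in> {1..6}"
  shows "w i j k l = 0"
proof -
  have r12: "w a a c d = 0" for a c d using s12[of a a c d] by simp
  have r23: "w a b b d = 0" for a b d using s23[of a b b d] by simp
  have r34: "w a b c c = 0" for a b c using s34[of a b c c] by simp
  have r13: "w a b a d = 0" for a b d using s12[of a b a d] r23[of b a d] by simp
  have r24: "w a b c b = 0" for a b c using s34[of a b c b] r23[of a b c] by simp
  have r14: "w a b c a = 0" for a b c using s12[of a b c a] r24[of b a c] by simp
  note repeated = r12 r23 r34 r13 r24 r14
  have swap: "w c d a b = w a b c d" for a b c d
    using s23[of c d a b] s12[of c a d b] s34[of a c d b] s23[of a c b d] by simp
  have lines: "w 1 2 3 4 = 0" "w 1 2 5 6 = 0" "w 3 4 5 6 = 0"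
    using trace[of 1 2] trace[of 3 4] trace[of 5 6] swap[of 1 2 3 4] swap[of 1 2 5 6] swap[of 3 4 5 6]
      repeated by simp_all
  have six: "a = 1 \<or> a = 2 \<or> a = 3 \<or> a = 4 \<or> a = 5 \<or> a = 6" if "a \<in> {1..6}" for a :: nat
    using that by auto
  have rev: "w 2 1 c d = - w 1 2 c d" "w 4 3 c d = - w 3 4 c d" "w 6 5 c d = - w 5 6 c d" for c d
    using s12 by blast+
  have line: "w a b 1 2 = 0 \<and> w a b 3 4 = 0 \<and> w a b 5 6 = 0" if "a \<in> {1..6}" "b \<in> {1..6}" for a b
    using six[OF that(1)] six[OF that(2)] trace[OF that]
    by (elim disjE; simp add: repeated lines lines[folded swap[of _ _ 1 2]] rev swap[of 1 2] swap[of 3 4 5 6]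
        del: One_nat_def)
  have pair: "w a b c d = 0"
    if "a \<in> {1..6}" "b \<in> {1..6}" "c \<in> {1..6}" "d \<in> {1..6}" "(c + 1) div 2 = (d + 1) div 2" for a b c d
  proof -
    have "c = d \<or> {c, d} = {1, 2} \<or> {c, d} = {3, 4} \<or> {c, d} = {5, 6}"
      using six[OF that(3)] six[OF that(4)] that(5) by (elim disjE; simp add: insert_commute)
    then show ?thesis
      using line[OF that(1,2)] s34[of a b 2 1] s34[of a b 4 3] s34[of a b 6 5] r34
      by (auto simp: doubleton_eq_iff)
  qed
  have pigeonhole: "x = y \<or> x = z \<or> x = t \<or> y = z \<or> y = t \<or> z = t"
    if "x \<in> {1, 2, 3}" "y \<in> {1, 2, 3}" "z \<in> {1, 2, 3}" "t \<in> {1, 2, 3}" for x y z t :: nat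
    using that by auto
  have "(a + 1) div 2 \<in> {1, 2, 3}" if "a \<in> {1..6}" for a :: nat
    using that by auto
  note classes = this[OF idx(1)] this[OF idx(2)] this[OF idx(3)] this[OF idx(4)]
  have "(i + 1) div 2 = (j + 1) div 2 \<or> (i + 1) div 2 = (k + 1) div 2 \<or> (i + 1) div 2 = (l + 1) div 2
      \<or> (j + 1) div 2 = (k + 1) div 2 \<or> (j + 1) div 2 = (l + 1) div 2 \<or> (k + 1) div 2 = (l + 1) div 2"
    by (rule pigeonhole[OF classes])
  then show ?thesis
  proof (elim disjE)
    assume "(i + 1) div 2 = (j + 1) div 2"
    then show ?thesis using pair[OF idx(3,4,1,2)] swap[of k l i j] by simp
  next
    assume "(i + 1) div 2 = (k + 1) div 2"
    then show ?thesis using pair[OF idx(2,4,1,3)] s23[of i j k l] swap[of j l i k] s34[of i k j l] by simp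
  next
    assume "(i + 1) div 2 = (l + 1) div 2"
    then show ?thesis using pair[OF idx(2,3,1,4)] s34[of i j k l] s23[of i j l k] swap[of j k i l] s34[of i l j k]
      by simp
  next
    assume "(j + 1) div 2 = (k + 1) div 2"
    then show ?thesis using pair[OF idx(1,4,2,3)] s34[of i j k l] s23[of i j l k] s34[of i l j k] by simp
  next
    assume "(j + 1) div 2 = (l + 1) div 2"
    then show ?thesis using pair[OF idx(1,3,2,4)] s23[of i j k l] by simp
  next
    assume "(k + 1) div 2 = (l + 1) div 2"
    then show ?thesis by (rule pair[OF idx])
  qed
qed


section \<open>Instantons and closed torsion\<close>

locale su3_hull = opposite_torsion A g D Dh + su3_connection A g D J \<Psi>
  for A :: "('m::{t2_space,second_countable_topology}, 6) chart set" and g D Dh J \<Psi>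
begin

abbreviation "dT \<equiv> ext_deriv3 T"

lemma instanton_if_closed:
  assumes "closed_3form A T"
  shows "su3_instanton A g J Dh"
proof -
  have R: "curvature4 g Dh X Y Z V p = curvature4 g D Z V X Y p"
    if "X \<in> VF" "Y \<in> VF" "Z \<in> VF" "V \<in> VF" for X Y Z V p
    using pair_exchange[of Z V X Y p] assms that by (simp add: closed_3form_def)
  show ?thesis
    unfolding su3_instanton_def
  proof (intro conjI ballI allI impI)
    fix X Y Z V assume "X \<in> VF" "Y \<in> VF" "Z \<in> VF" "V \<in> VF"
    then show "curvature4 g Dh (Jval J X) (Jval J Y) Z V = curvature4 g Dh X Y Z V"
      by (simp add: R Jval_closed curvature4_J_invariant fun_eq_iff)
  next
    fix Z V p and E :: "nat \<Rightarrow> 'm vfield"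
    assume *: "Z \<in> VF" "V \<in> VF" "(\<forall>i\<in>{1..6}. E i \<in> VF) \<and> orthonormal_basis A g p (\<lambda>i. E i p)"
    then have "(\<Sum>i=1..6. curvature4 g Dh (E i) (Jval J (E i)) Z V p)
        = (\<Sum>i=1..6. curvature4 g D Z V (E i) (Jval J (E i)) p)"
      by (intro sum.cong refl) (simp add: R Jval_closed)
    also have "\<dots> = 0"
      using * by (intro curvature_trace_zero) auto
    finally show "(\<Sum>i=1..6. curvature4 g Dh (E i) (Jval J (E i)) Z V p) = 0" .
  qed
qed

lemma dT_skew:
  assumes "X \<in> VF" "Y \<in> VF" "Z \<in> VF" "V \<in> VF"
  shows dT_skew_12: "dT X Y Z V p = - dT Y X Z V p"
    and dT_skew_23: "dT X Y Z V p = - dT X Z Y V p"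
    and dT_skew_34: "dT X Y Z V p = - dT X Y V Z p"
proof -
  note N = N_perms[OF assms, of p] N_perms[OF assms(2,1,3,4), of p] N_perms[OF assms(3,1,2,4), of p]
    N_perms[OF assms(4,1-3), of p]
  note Q = Q_perms[OF assms, of p] Q_perms[OF assms(1,3,2,4), of p] Q_perms[OF assms(1,4,2,3), of p]
  show "dT X Y Z V p = - dT Y X Z V p"
    unfolding ext_deriv_torsion[OF assms] ext_deriv_torsion[OF assms(2,1,3,4)] N Q by simp
  show "dT X Y Z V p = - dT X Z Y V p"
    unfolding ext_deriv_torsion[OF assms] ext_deriv_torsion[OF assms(1,3,2,4)] N Q by simp
  show "dT X Y Z V p = - dT X Y V Z p"
    unfolding ext_deriv_torsion[OF assms] ext_deriv_torsion[OF assms(1,2,4,3)] N Q by simp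
qed

lemma dT_linear_4:
  assumes "X \<in> VF" "Y \<in> VF" "Z \<in> VF" "V \<in> VF" "V' \<in> VF"
  shows dT_add: "dT X Y Z (V + V') p = dT X Y Z V p + dT X Y Z V' p"
    and dT_scale: "dT X Y Z (c *\<^sub>R V) p = c *\<^sub>R dT X Y Z V p"
proof -
  have 2: "curvature4 g Dh Z W X Y p = - curvature4 g Dh W Z X Y p" if "W \<in> VF" for W
    using assms that by (intro H.curvature4_skew_12)
  show "dT X Y Z (V + V') p = dT X Y Z V p + dT X Y Z V' p"
    using assms by (simp add: pair_exchange 2 vf_add curvature4_linear_4 H.curvature4_linear_1)
  show "dT X Y Z (c *\<^sub>R V) p = c *\<^sub>R dT X Y Z V p"
    using assms by (simp add: pair_exchange 2 vf_scale curvature4_linear_4(2)[where V' = V']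
        H.curvature4_linear_1(2)[where X' = V'] algebra_simps)
qed

context
  assumes instanton: "su3_instanton A g J Dh"
begin

lemma dT_J_invariant:
  assumes "X \<in> VF" "Y \<in> VF" "Z \<in> VF" "V \<in> VF"
  shows "dT X Y (Jval J Z) (Jval J V) p = dT X Y Z V p"
proof -
  have "curvature4 g Dh (Jval J Z) (Jval J V) X Y = curvature4 g Dh Z V X Y"
    using instanton assms by (simp add: su3_instanton_def)
  then show ?thesis
    using assms by (simp add: pair_exchange Jval_closed curvature4_J_invariant)
qed

lemma dT_trace_zero:
  assumes X: "X \<in> VF" and Y: "Y \<in> VF" and E: "\<And>i. i \<in> {1..6} \<Longrightarrow> E i \<in> VF"
    and basis: "orthonormal_basis A g p (\<lambda>i. E i p)"
  shows "(\<Sum>i\<in>{1..6}. dT X Y (E i) (Jval J (E i)) p) = 0"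
proof -
  have "(\<Sum>i=1..6. curvature4 g Dh (E i) (Jval J (E i)) X Y p) = 0"
    using instanton X Y E basis unfolding su3_instanton_def by blast
  moreover have "(\<Sum>i\<in>{1..6}. dT X Y (E i) (Jval J (E i)) p)
      = (\<Sum>i\<in>{1..6}. 2 * curvature4 g D X Y (E i) (Jval J (E i)) p
        - 2 * curvature4 g Dh (E i) (Jval J (E i)) X Y p)"
    using X Y E by (intro sum.cong refl) (simp add: pair_exchange Jval_closed right_diff_distrib)
  ultimately show ?thesis
    using curvature_trace_zero[OF X Y E basis]
    by (simp add: sum_subtractf sum_distrib_left[symmetric])
qed

text \<open>The trace condition holds for every family of fields that is orthonormal at \<open>p\<close>. Adding to
  one member of the family a field \<open>P\<close> or \<open>- P\<close> that vanishes at \<open>p\<close> does not affect this, so the part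
  of the trace that is linear in \<open>P\<close> vanishes; by \<open>J\<close>-invariance its two terms are equal.\<close>

lemma dT_vanishing_field_basis:
  assumes X: "X \<in> VF" and Y: "Y \<in> VF" and P: "P \<in> VF" "P p = 0"
    and F: "\<And>i. F i \<in> VF" and basis: "orthonormal_basis A g p (\<lambda>i. F i p)" and i: "i \<in> {1..6}"
  shows "dT X Y P (Jval J (F i)) p = 0"
proof -
  define B where "B = (\<lambda>U V. dT X Y U (Jval J V) p)"
  have right: "B U (V + W) = B U V + B U W" "B U (- V) = - B U V"
    if "U \<in> VF" "V \<in> VF" "W \<in> VF" for U V W
    using dT_add[OF X Y that(1) Jval_closed[OF that(2)] Jval_closed[OF that(3)], of p]
      dT_scale[OF X Y that(1) Jval_closed[OF that(2)] Jval_closed[OF that(3)], of "-1" p] that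
    by (simp_all add: B_def Jval_add Jval_minus)
  have symm: "B U V = B V U" if "U \<in> VF" "V \<in> VF" for U V
  proof -
    have "B U V = dT X Y (Jval J U) (Jval J (Jval J V)) p"
      using dT_J_invariant[OF X Y that(1) Jval_closed[OF that(2)]] by (simp add: B_def)
    also have "\<dots> = - dT X Y (Jval J U) V p"
      using dT_scale[OF X Y Jval_closed[OF that(1)] that(2) that(2), of "-1" p] Jval_Jval[OF that(2,2)]
      by simp
    also have "\<dots> = B V U"
      using dT_skew_34[OF X Y Jval_closed[OF that(1)] that(2)] by (simp add: B_def)
    finally show ?thesis .
  qed
  have right_diff: "B U (V - W) = B U V - B U W" if "U \<in> VF" "V \<in> VF" "W \<in> VF" for U V W
    using right(1)[OF that(1,2) vf_minus[OF that(3)]] right(2)[OF that(1,3,3)] by simp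
  have left: "B (V + W) U = B V U + B W U" "B (V - W) U = B V U - B W U"
    if "U \<in> VF" "V \<in> VF" "W \<in> VF" for U V W
    using right(1)[OF that] right_diff[OF that] symm[OF that(1,2)] symm[OF that(1,3)]
      symm[OF that(1) vf_add[OF that(2,3)]] symm[OF that(1) vf_diff[OF that(2,3)]] by simp_all
  have trace: "B (F i + W) (F i + W) = B (F i) (F i)" if W: "W \<in> VF" "W p = 0" for W
  proof -
    define G where "G = F(i := F i + W)"
    have G: "G k = F k" if "k \<noteq> i" for k
      using that by (simp add: G_def)
    have split: "(\<Sum>k\<in>{1..6}. B (H k) (H k)) = B (H i) (H i) + (\<Sum>k\<in>{1..6} - {i}. B (H k) (H k))" for H
      using i by (intro sum.remove) auto
    have "(\<lambda>k. G k p) = (\<lambda>k. F k p)" using W by (auto simp: G_def fun_eq_iff)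
    then have "(\<Sum>k\<in>{1..6}. B (G k) (G k)) = 0"
      unfolding B_def using basis F W by (intro dT_trace_zero[OF X Y]) (auto simp: G_def vf_add)
    moreover have "(\<Sum>k\<in>{1..6}. B (F k) (F k)) = 0"
      unfolding B_def using basis F by (intro dT_trace_zero[OF X Y])
    moreover have "(\<Sum>k\<in>{1..6} - {i}. B (G k) (G k)) = (\<Sum>k\<in>{1..6} - {i}. B (F k) (F k))"
      using G by (intro sum.cong refl) simp
    ultimately have "B (G i) (G i) = B (F i) (F i)"
      using split[of G] split[of F] by linarith
    then show ?thesis by (simp add: G_def)
  qed
  have "B P (F i) + B (F i) P + B P P = 0"
    using trace[OF P] F P by (simp add: left right vf_add)
  moreover have "- B P (F i) - B (F i) P + B P P = 0"
    using trace[of "- P"] F P by (simp add: left right_diff vf_diff vf_minus)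
  ultimately have "B P (F i) = 0"
    using symm[OF P(1) F, of i] by simp
  then show ?thesis by (simp add: B_def)
qed

text \<open>Hence \<open>dT\<close> at \<open>p\<close> depends only on the values at \<open>p\<close> of its arguments.\<close>

lemma dT_local:
  assumes X: "X \<in> VF" and Y: "Y \<in> VF" and U: "U \<in> VF" and P: "P \<in> VF" "P p = 0"
  shows "dT X Y U P p = 0"
proof -
  obtain e where "adapted_basis p e" using adapted_basis_exists by blast
  then have e: "orthonormal_basis A g p e" by (simp add: adapted_basis_def)
  obtain F where F_ext: "\<forall>i. F i \<in> VF" "\<forall>i\<in>{1..6}. F i p = e i"
    using vfields_basis_extension[OF e] by (elim exE conjE)
  note F = F_ext[rule_format]
  have basis_cong: "orthonormal_basis A g p (\<lambda>i. G i p)" if "\<forall>i\<in>{1..6}. G i p = e i" for G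
  proof -
    have "(\<lambda>i. G i p) ` {1..6} = e ` {1..6}" using that by (intro image_cong) auto
    then show ?thesis using e that by (simp add: orthonormal_basis_def)
  qed
  have basis: "orthonormal_basis A g p (\<lambda>i. F i p)"
    by (rule basis_cong[of F, OF F_ext(2)])
  define L where "L = (\<lambda>V. dT X Y P (Jval J V) p)"
  have "L V = 0" if "V \<in> VF" for V
  proof (rule vfield_functional_zero[OF basis F(1), of L])
    show "L (U + V) = L U + L V" if "U \<in> VF" "V \<in> VF" for U V
      using that X Y P by (simp add: L_def Jval_add dT_add Jval_closed)
    show "L (c *\<^sub>R U) = c *\<^sub>R L U" if "U \<in> VF" for c U
      using dT_scale[OF X Y P(1) Jval_closed[OF that] Jval_closed[OF that]] that
      by (simp add: L_def Jval_scale[OF that that])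
    show L0: "L (F i) = 0" if "i \<in> {1..6}" for i
      unfolding L_def by (rule dT_vanishing_field_basis[OF X Y P F(1) basis that])
    show "L Q = 0" if Q: "Q \<in> VF" "Q p = 0" for Q
    proof -
      \<comment> \<open>The preceding lemma also applies to the frame with \<open>Q\<close> added to its first member.\<close>
      let ?G = "F(1 := F 1 + Q)"
      have G: "?G i \<in> VF" for i using F(1) Q(1) by (simp add: vf_add)
      have "orthonormal_basis A g p (\<lambda>i. ?G i p)"
        by (rule basis_cong) (use F Q in auto)
      then have "L (?G 1) = 0"
        unfolding L_def by (rule dT_vanishing_field_basis[OF X Y P G]) simp
      then have "L (F 1 + Q) = 0" by simp
      then show ?thesis
        using L0[of 1] dT_add[OF X Y P(1) Jval_closed[OF F(1)[of 1]] Jval_closed[OF Q(1)], of p] F(1) Q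
        by (simp add: L_def Jval_add)
    qed
    show "V \<in> VF" by fact
  qed
  from this[OF vf_minus[OF Jval_closed[OF U]]] have "dT X Y P U p = 0"
    using U by (simp add: L_def Jval_minus[OF Jval_closed Jval_closed] Jval_Jval[OF U U])
  then show ?thesis using dT_skew_34[OF X Y U P(1)] by simp
qed

lemma closed_if_instanton: "closed_3form A T"
  unfolding closed_3form_def
proof (intro ballI)
  fix X Y Z V assume mem: "X \<in> VF" "Y \<in> VF" "Z \<in> VF" "V \<in> VF"
  show "dT X Y Z V = 0"
  proof
    fix p
    obtain e where "adapted_basis p e" using adapted_basis_exists by blast
    then have e: "orthonormal_basis A g p e"
      and Je: "J p (e 1) = e 2" "J p (e 2) = - e 1" "J p (e 3) = e 4" "J p (e 4) = - e 3"
        "J p (e 5) = e 6" "J p (e 6) = - e 5"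
      by (auto simp: adapted_basis_def)
    obtain F where F_ext: "\<forall>i. F i \<in> VF" "\<forall>i\<in>{1..6}. F i p = e i"
      using vfields_basis_extension[OF e] by (elim exE conjE)
    note F = F_ext[rule_format]
    have basis: "orthonormal_basis A g p (\<lambda>i. F i p)"
    proof -
      have "(\<lambda>i. F i p) ` {1..6} = e ` {1..6}" using F(2) by (intro image_cong) auto
      then show ?thesis using e F(2) by (simp add: orthonormal_basis_def)
    qed
    have local: "dT P Q R S p = dT P Q R S' p"
      if "P \<in> VF" "Q \<in> VF" "R \<in> VF" "S \<in> VF" "S' \<in> VF" "S p = S' p" for P Q R S S'
      using dT_add[OF that(1-3,5) vf_diff[OF that(4,5)], of p] dT_local[OF that(1-3) vf_diff[OF that(4,5)], of p]
        that(6) by simp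
    define w where "w = (\<lambda>i j k l. dT (F i) (F j) (F k) (F l) p)"
    have "w i j k l = 0" if "i \<in> {1..6}" "j \<in> {1..6}" "k \<in> {1..6}" "l \<in> {1..6}" for i j k l
    proof (rule primitive_4form_zero[OF _ _ _ _ that])
      show skew: "w a b c d = - w b a c d" "w a b c d = - w a c b d" "w a b c d = - w a b d c" for a b c d
        unfolding w_def by (rule dT_skew_12 dT_skew_23 dT_skew_34, (rule F(1))+)+
      show "w a b 1 2 + w a b 3 4 + w a b 5 6 = 0" if "a \<in> {1..6}" "b \<in> {1..6}" for a b
      proof -
        have J: "dT (F a) (F b) (F c) (Jval J (F c)) p = w a b c d"
          if "c \<in> {1..6}" "d \<in> {1..6}" "J p (e c) = e d" for c d
          unfolding w_def using that F(2)
          by (intro local[OF F(1) F(1) F(1) Jval_closed[OF F(1)] F(1)]) (simp add: Jval_def)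
        have Jm: "dT (F a) (F b) (F c) (Jval J (F c)) p = - w a b c d"
          if "c \<in> {1..6}" "d \<in> {1..6}" "J p (e c) = - e d" for c d
        proof -
          have "dT (F a) (F b) (F c) (Jval J (F c)) p = dT (F a) (F b) (F c) ((- 1) *\<^sub>R F d) p"
            using that F(2)
            by (intro local[OF F(1) F(1) F(1) Jval_closed[OF F(1)] vf_scale[OF F(1)]]) (simp add: Jval_def)
          also have "\<dots> = (- 1) *\<^sub>R w a b c d"
            unfolding w_def by (rule dT_scale) (rule F(1))+
          finally show ?thesis by simp
        qed
        have six: "{1..6} = {1, 2, 3, 4, 5, 6::nat}" by auto
        have "w a b 1 2 + - w a b 2 1 + w a b 3 4 + - w a b 4 3 + w a b 5 6 + - w a b 6 5
            = (\<Sum>c\<in>{1..6}. dT (F a) (F b) (F c) (Jval J (F c)) p)"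
          unfolding six
          using J[OF _ _ Je(1)] Jm[OF _ _ Je(2)] J[OF _ _ Je(3)] Jm[OF _ _ Je(4)] J[OF _ _ Je(5)] Jm[OF _ _ Je(6)]
          by (simp del: One_nat_def)
        also have "\<dots> = 0" by (rule dT_trace_zero[OF F(1) F(1) F(1) basis])
        finally show ?thesis using skew(3)[of a b 2 1] skew(3)[of a b 4 3] skew(3)[of a b 6 5] by simp
      qed
    qed
    then have base: "dT (F i) (F j) (F k) (F l) p = 0"
      if "i \<in> {1..6}" "j \<in> {1..6}" "k \<in> {1..6}" "l \<in> {1..6}" for i j k l
      using that by (simp add: w_def)
    \<comment> \<open>A slot at a time, the basis fields are replaced by arbitrary ones.\<close>
    have extend: "dT P Q R S p = 0" if "P \<in> VF" "Q \<in> VF" "R \<in> VF" "S \<in> VF"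
      and zero: "\<And>l. l \<in> {1..6} \<Longrightarrow> dT P Q R (F l) p = 0" for P Q R S
    proof (rule vfield_functional_zero[OF basis F(1), of "\<lambda>S. dT P Q R S p"])
      show "dT P Q R (U + W) p = dT P Q R U p + dT P Q R W p" if "U \<in> VF" "W \<in> VF" for U W
        by (rule dT_add) fact+
      show "dT P Q R (c *\<^sub>R U) p = c *\<^sub>R dT P Q R U p" if "U \<in> VF" for c U
        by (rule dT_scale) fact+
      show "dT P Q R U p = 0" if "U \<in> VF" "U p = 0" for U
        by (rule dT_local) fact+
    qed fact+
    have 4: "dT (F i) (F j) (F k) V p = 0" if "i \<in> {1..6}" "j \<in> {1..6}" "k \<in> {1..6}" for i j k
      by (rule extend[OF F(1) F(1) F(1) mem(4) base[OF that]])
    have 3: "dT (F i) (F j) V Z p = 0" if "i \<in> {1..6}" "j \<in> {1..6}" for i j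
    proof (rule extend)
      show "dT (F i) (F j) V (F k) p = 0" if "k \<in> {1..6}" for k
        using dT_skew_34[OF F(1) F(1) mem(4) F(1), of i j k p] 4[of i j k] that \<open>i \<in> {1..6}\<close> \<open>j \<in> {1..6}\<close>
        by simp
    qed (use F(1) mem in auto)
    have 2: "dT (F i) V Z Y p = 0" if "i \<in> {1..6}" for i
    proof (rule extend)
      show "dT (F i) V Z (F j) p = 0" if "j \<in> {1..6}" for j
        using dT_skew_34[OF F(1) mem(4,3) F(1), of i j p] dT_skew_23[OF F(1) mem(4) F(1) mem(3), of i j p]
          3[of i j] that \<open>i \<in> {1..6}\<close> by simp
    qed (use F(1) mem in auto)
    have "dT V Z Y X p = 0"
    proof (rule extend)
      show "dT V Z Y (F i) p = 0" if "i \<in> {1..6}" for i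
        using dT_skew_34[OF mem(4,3,2) F(1), of i p] dT_skew_23[OF mem(4,3) F(1) mem(2), of i p]
          dT_skew_12[OF mem(4) F(1) mem(3,2), of i p] 2[OF that] by simp
    qed (use mem in auto)
    then show "dT X Y Z V p = 0 p"
      using dT_skew_12[OF mem, of p] dT_skew_23[OF mem(2,1,3,4), of p] dT_skew_34[OF mem(2,3,1,4), of p]
        dT_skew_12[OF mem(2,3,4,1), of p] dT_skew_23[OF mem(3,2,4,1), of p] dT_skew_12[OF mem(3,4,2,1), of p]
      by simp
  qed
qed

end

end

text \<open>Both connections send vector fields to vector fields, and twice the bracket is a combination of
  their values.\<close>

lemma bracket_closed_of_opposite_torsion:
  assumes A: "smooth_manifold A" and conn: "linear_connection A D" "linear_connection A Dh"
    and opposite: "torsion Dh X Y = - torsion D X Y"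
    and mem: "X \<in> vfields A" "Y \<in> vfields A"
  shows "lie_bracket X Y \<in> vfields A"
proof -
  have closed: "D X Y \<in> vfields A" "D Y X \<in> vfields A" "Dh X Y \<in> vfields A" "Dh Y X \<in> vfields A"
    using conn mem by (simp_all add: linear_connection_def)
  have "lie_bracket X Y = (1/2) *\<^sub>R (D X Y - D Y X + (Dh X Y - Dh Y X))"
    using opposite by (simp add: torsion_def fun_eq_iff scaleR_fun_def algebra_simps)
  then show ?thesis
    using closed
    by (auto intro!: subspace_scale subspace_add subspace_diff subspace_vfields[OF A])
qed

theorem theorem1p5:
  fixes A :: "('m::{t2_space,second_countable_topology}, 6) chart set"
    and g :: "'m bilin" and J :: "'m endo" and \<Psi> :: "'m cform3"
    and D Dh :: "'m connection"
  assumes "smooth_manifold A"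
    and "acyt A g J \<Psi>"
    and "torsion_connection A g J \<Psi> D"
    and "hull_connection A g D Dh"
  shows "su3_instanton A g J Dh \<longleftrightarrow> closed_3form A (torsion_form g D)"
proof -
  have su3: "su3_structure A g J \<Psi>" using assms(2) by (simp add: acyt_def)
  then have metric: "riemannian_metric A g"
    by (simp add: su3_structure_def almost_hermitian_def)
  have bracket: "lie_bracket X Y \<in> vfields A" if "X \<in> vfields A" "Y \<in> vfields A" for X Y
    using bracket_closed_of_opposite_torsion[OF assms(1), of D Dh X Y] assms(3,4) that
    by (simp add: torsion_connection_def hull_connection_def)
  interpret su3_hull A g D Dh J \<Psi>
    by unfold_locales
      (use assms su3 metric bracket in \<open>simp_all add: torsion_connection_def hull_connection_def\<close>)
  show ?thesis
    using instanton_if_closed closed_if_instanton by blast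
qed

end
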